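(* There is an algorithm that, given a permutation graph $G$ with $n=|V(G)|$ and $m=|E(G)|$ together with a permutation representation of $G$, solves the Maximum Edge Open Packing problem on $G$ (that is, finds an edge open packing of $G$ of maximum cardinality $\rho_e^o(G)$) in $O(n^2+m^2)$ time.
   Context: All graphs are finite, simple and undirected. Two distinct edges $e_1,e_2\in E(G)$ have a common edge if there is an edge $e\in E(G)\setminus\{e_1,e_2\}$ joining an endpoint of $e_1$ to an endpoint of $e_2$. A set $D\subseteq E(G)$ is an edge open packing if no two edges of $D$ have a common edge. The edge open packing number $\rho_e^o(G)$ is the maximum cardinality of an edge open packing of $G$. The Maximum Edge Open Packing problem asks for an edge open packing of maximum cardinality. A graph $G$ is a permutation graph if there are two linear orders $<_1,<_2$ on $V(G)$ such that two vertices are adjacent precisely when they occur in opposite orders in $<_1$ and $<_2$; such a pair $(<_1,<_2)$ is a permutation representation of $G$. *)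

theory Defs
  imports Main
begin

section \<open>Edge open packings and permutation graphs\<close>

text \<open>A graph is given by its vertex set and its set of edges, each edge being a set of two vertices.\<close>

definition simple_graph :: "'a set \<Rightarrow> 'a set set \<Rightarrow> bool" where
  "simple_graph V E \<longleftrightarrow> finite V \<and> (\<forall>e\<in>E. e \<subseteq> V \<and> card e = 2)"

definition common_edge :: "'a set set \<Rightarrow> 'a set \<Rightarrow> 'a set \<Rightarrow> bool" where
  "common_edge E e1 e2 \<longleftrightarrow> (\<exists>e \<in> E - {e1, e2}. \<exists>u\<in>e1. \<exists>v\<in>e2. e = {u, v})"

definition edge_open_packing :: "'a set set \<Rightarrow> 'a set set \<Rightarrow> bool" where
  "edge_open_packing E D \<longleftrightarrow>
     D \<subseteq> E \<and> (\<forall>e1\<in>D. \<forall>e2\<in>D. e1 \<noteq> e2 \<longrightarrow> \<not> common_edge E e1 e2)"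

definition edge_open_packing_number :: "'a set set \<Rightarrow> nat" where
  "edge_open_packing_number E = Max (card ` {D. edge_open_packing E D})"

text \<open>The orders are reflexive, as everywhere in the library; only distinct vertices are compared.\<close>

definition permutation_representation :: "'a set \<Rightarrow> 'a set set \<Rightarrow> 'a rel \<Rightarrow> 'a rel \<Rightarrow> bool" where
  "permutation_representation V E r1 r2 \<longleftrightarrow>
     linear_order_on V r1 \<and> linear_order_on V r2 \<and>
     (\<forall>u\<in>V. \<forall>v\<in>V. u \<noteq> v \<longrightarrow>
        ({u, v} \<in> E \<longleftrightarrow>
           (u, v) \<in> r1 \<and> (v, u) \<in> r2 \<or> (v, u) \<in> r1 \<and> (u, v) \<in> r2))"


section \<open>Word RAM programs and their running time\<close>

text \<open>
  The memory consists of finitely many (per program) named arrays of natural numbers; a scalar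
  variable is the cell with index 0 of its array.  Programs are structured, and every operator,
  memory access and elementary command costs one time unit.
\<close>

type_synonym mem = "string \<Rightarrow> nat \<Rightarrow> nat"

datatype expr =
    Num nat
  | Cell string expr
  | Add expr expr
  | Sub expr expr
  | Mul expr expr

datatype test =
    Less expr expr
  | Neg test
  | Conj test test

datatype com =
    Skip
  | Assign string expr expr
  | Seq com com
  | Cond test com com
  | While test com

fun eval :: "mem \<Rightarrow> expr \<Rightarrow> nat" where
  "eval s (Num k) = k"
| "eval s (Cell x i) = s x (eval s i)"
| "eval s (Add a b) = eval s a + eval s b"
| "eval s (Sub a b) = eval s a - eval s b"
| "eval s (Mul a b) = eval s a * eval s b"

text \<open>
  \<open>fits W s e\<close> says that no number arising in the evaluation of \<open>e\<close> exceeds \<open>W\<close>; this applies to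
  the addresses of memory accesses as well.
\<close>

fun fits :: "nat \<Rightarrow> mem \<Rightarrow> expr \<Rightarrow> bool" where
  "fits W s (Num k) \<longleftrightarrow> k \<le> W"
| "fits W s (Cell x i) \<longleftrightarrow> fits W s i \<and> eval s (Cell x i) \<le> W"
| "fits W s (Add a b) \<longleftrightarrow> fits W s a \<and> fits W s b \<and> eval s (Add a b) \<le> W"
| "fits W s (Sub a b) \<longleftrightarrow> fits W s a \<and> fits W s b \<and> eval s (Sub a b) \<le> W"
| "fits W s (Mul a b) \<longleftrightarrow> fits W s a \<and> fits W s b \<and> eval s (Mul a b) \<le> W"

fun cost :: "expr \<Rightarrow> nat" where
  "cost (Num k) = 1"
| "cost (Cell x i) = cost i + 1"
| "cost (Add a b) = cost a + cost b + 1"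
| "cost (Sub a b) = cost a + cost b + 1"
| "cost (Mul a b) = cost a + cost b + 1"

fun holds :: "mem \<Rightarrow> test \<Rightarrow> bool" where
  "holds s (Less a b) \<longleftrightarrow> eval s a < eval s b"
| "holds s (Neg p) \<longleftrightarrow> \<not> holds s p"
| "holds s (Conj p q) \<longleftrightarrow> holds s p \<and> holds s q"

fun test_fits :: "nat \<Rightarrow> mem \<Rightarrow> test \<Rightarrow> bool" where
  "test_fits W s (Less a b) \<longleftrightarrow> fits W s a \<and> fits W s b"
| "test_fits W s (Neg p) \<longleftrightarrow> test_fits W s p"
| "test_fits W s (Conj p q) \<longleftrightarrow> test_fits W s p \<and> test_fits W s q"

fun test_cost :: "test \<Rightarrow> nat" where
  "test_cost (Less a b) = cost a + cost b + 1"
| "test_cost (Neg p) = test_cost p + 1"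
| "test_cost (Conj p q) = test_cost p + test_cost q + 1"

text \<open>
  \<open>run W c s t s'\<close>: started in memory \<open>s\<close>, the program \<open>c\<close> halts after \<open>t\<close> time units in
  memory \<open>s'\<close>, and all numbers computed on the way are at most \<open>W\<close>.  On overflow there is no
  result, so unit cost per operation is never paid for numbers longer than a machine word.
\<close>

inductive run :: "nat \<Rightarrow> com \<Rightarrow> mem \<Rightarrow> nat \<Rightarrow> mem \<Rightarrow> bool" for W :: nat where
  Skip: "run W Skip s 1 s"
| Assign: "fits W s i \<Longrightarrow> fits W s e \<Longrightarrow>
    run W (Assign x i e) s (cost i + cost e + 1) (s(x := (s x)(eval s i := eval s e)))"
| Seq: "run W c1 s t1 s1 \<Longrightarrow> run W c2 s1 t2 s2 \<Longrightarrow> run W (Seq c1 c2) s (t1 + t2) s2"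
| CondTrue: "test_fits W s p \<Longrightarrow> holds s p \<Longrightarrow> run W c1 s t s' \<Longrightarrow>
    run W (Cond p c1 c2) s (test_cost p + 1 + t) s'"
| CondFalse: "test_fits W s p \<Longrightarrow> \<not> holds s p \<Longrightarrow> run W c2 s t s' \<Longrightarrow>
    run W (Cond p c1 c2) s (test_cost p + 1 + t) s'"
| WhileFalse: "test_fits W s p \<Longrightarrow> \<not> holds s p \<Longrightarrow>
    run W (While p c) s (test_cost p + 1) s"
| WhileTrue: "test_fits W s p \<Longrightarrow> holds s p \<Longrightarrow> run W c s t1 s1 \<Longrightarrow>
    run W (While p c) s1 t2 s2 \<Longrightarrow> run W (While p c) s (test_cost p + 1 + t1 + t2) s2"

inductive_cases run_SkipE: "run W Skip s t s'"
inductive_cases run_AssignE: "run W (Assign x i e) s t s'"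
inductive_cases run_SeqE: "run W (Seq c1 c2) s t s'"
inductive_cases run_CondE: "run W (Cond p c1 c2) s t s'"
inductive_cases run_WhileE: "run W (While p c) s t s'"

lemma run_deterministic:
  "run W c s t s' \<Longrightarrow> run W c s u s'' \<Longrightarrow> t = u \<and> s' = s''"
proof (induction arbitrary: u s'' rule: run.induct)
  case (Skip s)
  then show ?case by (elim run_SkipE) simp
next
  case (Assign s i e x)
  from Assign.prems show ?case by (elim run_AssignE) simp
next
  case (Seq c1 s t1 s1 c2 t2 s2)
  from Seq.prems show ?case by (elim run_SeqE) (metis Seq.IH)
next
  case (CondTrue s p c1 t s' c2)
  from CondTrue.prems show ?case
    by (rule run_CondE) (auto simp: CondTrue.hyps dest!: CondTrue.IH)
next
  case (CondFalse s p c2 t s' c1)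
  from CondFalse.prems show ?case
    by (rule run_CondE) (auto simp: CondFalse.hyps dest!: CondFalse.IH)
next
  case (WhileFalse s p c)
  from WhileFalse.prems show ?case
    by (rule run_WhileE) (simp_all add: WhileFalse.hyps)
next
  case (WhileTrue s p c t1 s1 t2 s2)
  from WhileTrue.prems show ?case
    by (rule run_WhileE) (auto simp: WhileTrue.hyps dest!: WhileTrue.IH)
qed


section \<open>Input and output\<close>

text \<open>An edge list contains every edge exactly once, with its endpoints in either order.\<close>

definition edge_list :: "'a set set \<Rightarrow> ('a \<times> 'a) list \<Rightarrow> bool" where
  "edge_list E es \<longleftrightarrow> (\<lambda>(u, v). {u, v}) ` set es = E \<and> length es = card E"

definition order_list :: "'a set \<Rightarrow> 'a rel \<Rightarrow> 'a list \<Rightarrow> bool" where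
  "order_list V r xs \<longleftrightarrow> distinct xs \<and> set xs = V \<and> sorted_wrt (\<lambda>u v. (u, v) \<in> r) xs"

definition array :: "nat list \<Rightarrow> nat \<Rightarrow> nat" where
  "array xs i = (if i < length xs then xs ! i else 0)"

text \<open>
  Initially the memory holds the numbers \<open>n\<close> and \<open>m\<close> of vertices and edges, the edges, and the
  vertices in the two orders of the permutation representation.  All other cells are 0.
\<close>

definition input_mem :: "nat \<Rightarrow> (nat \<times> nat) list \<Rightarrow> nat list \<Rightarrow> nat list \<Rightarrow> mem" where
  "input_mem n es xs ys = (\<lambda>_. array [])(
     ''n'' := array [n],
     ''m'' := array [length es],
     ''edge_fst'' := array (map fst es),
     ''edge_snd'' := array (map snd es),
     ''order1'' := array xs,
     ''order2'' := array ys)"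

definition output_edges :: "mem \<Rightarrow> (nat \<times> nat) list" where
  "output_edges s = map (\<lambda>i. (s ''out_fst'' i, s ''out_snd'' i)) [0..<s ''out_size'' 0]"

end

theory Submission
  imports Defs
begin

text \<open>
  The edges of an edge open packing form an induced star forest.  Orient every packed edge from the
  centre of its star to the leaf.  In a permutation graph two nonadjacent vertices are comparable in
  the order \<open>before in both linear orders\<close>, so the leaves of a star form a chain, and of two stars
  without an edge between them one lies completely before the other.  Hence edge open packings are
  exactly the chains of a strict partial order on the \<open>2m\<close> arcs, and a longest chain is found by
  dynamic programming.  The sum of the positions of the two endpoints in the first order is a linear
  extension with values below \<open>2n\<close>, so the arcs are processed bucket by bucket without sorting.
\<close>


section \<open>Running time of programs\<close>

text \<open>Compatibility of undirected edges is not transitive: on a path \<open>a\<close>,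
  \<open>b\<close>, \<open>c\<close>, \<open>d\<close> the middle edge is compatible with both outer
  edges, but these have the middle edge as a common edge. A fixed centre repairs this, since two
  arcs that share a vertex are comparable only if it is the centre of both. Transitivity lets the
  dynamic program remember only the last arc of a chain. Optimality is a potential argument: the
  computed length increases strictly along the order, with values in an interval whose size is
  attained by the chain that is output. No maximum over all chains is ever formed. The time bound
  separates two costs. Each of the \<open>2 * n\<close> buckets looks at all \<open>2 * m\<close>
  arcs with constant work, but the search for a predecessor runs only in the bucket of the arc,
  hence once per arc. This gives the order \<open>n * m + m * m\<close> up to lower terms, and
  \<open>n * m\<close> is at most \<open>n * n + m * m\<close>.\<close>

definition wpt :: "nat \<Rightarrow> com \<Rightarrow> (nat \<Rightarrow> mem \<Rightarrow> bool) \<Rightarrow> mem \<Rightarrow> bool" where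
  "wpt W c Q s \<longleftrightarrow> (\<exists>t s'. run W c s t s' \<and> Q t s')"

text \<open>The rules are equations, so the simplifier executes straight-line code symbolically and
  sums its cost on the way. Halting and absence of overflow are part of \<open>wpt\<close>, since
  \<open>run\<close> yields no result otherwise.\<close>

lemma wpt_Skip: "wpt W Skip Q s \<longleftrightarrow> Q 1 s"
  unfolding wpt_def by (metis run.Skip run_SkipE)

lemma wpt_Assign:
  "wpt W (Assign x i e) Q s \<longleftrightarrow>
     fits W s i \<and> fits W s e \<and> Q (cost i + cost e + 1) (s(x := (s x)(eval s i := eval s e)))"
  unfolding wpt_def by (metis run.Assign run_AssignE)

lemma wpt_Seq:
  "wpt W (Seq c1 c2) Q s \<longleftrightarrow> wpt W c1 (\<lambda>t1. wpt W c2 (\<lambda>t2. Q (t1 + t2))) s"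
proof
  assume "wpt W (Seq c1 c2) Q s"
  then obtain t s' where "run W (Seq c1 c2) s t s'" "Q t s'" unfolding wpt_def by blast
  then show "wpt W c1 (\<lambda>t1. wpt W c2 (\<lambda>t2. Q (t1 + t2))) s"
    unfolding wpt_def by (elim run_SeqE) (intro exI conjI, assumption+, simp)
next
  assume "wpt W c1 (\<lambda>t1. wpt W c2 (\<lambda>t2. Q (t1 + t2))) s"
  then obtain t1 s1 t2 s2 where r: "run W c1 s t1 s1" "run W c2 s1 t2 s2" and Q: "Q (t1 + t2) s2"
    unfolding wpt_def by auto
  from run.Seq[OF r] Q show "wpt W (Seq c1 c2) Q s"
    unfolding wpt_def by blast
qed

lemma wpt_Cond:
  "wpt W (Cond p c1 c2) Q s \<longleftrightarrow>
     test_fits W s p \<and> wpt W (if holds s p then c1 else c2) (\<lambda>t. Q (test_cost p + 1 + t)) s"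
proof
  assume "wpt W (Cond p c1 c2) Q s"
  then obtain t s' where "run W (Cond p c1 c2) s t s'" "Q t s'" unfolding wpt_def by blast
  then show "test_fits W s p \<and>
      wpt W (if holds s p then c1 else c2) (\<lambda>t. Q (test_cost p + 1 + t)) s"
    unfolding wpt_def by (elim run_CondE) auto
next
  assume "test_fits W s p \<and>
      wpt W (if holds s p then c1 else c2) (\<lambda>t. Q (test_cost p + 1 + t)) s"
  then obtain t s' where p: "test_fits W s p" and r: "run W (if holds s p then c1 else c2) s t s'"
    and Q: "Q (test_cost p + 1 + t) s'"
    unfolding wpt_def by blast
  have "run W (Cond p c1 c2) s (test_cost p + 1 + t) s'"
    using run.CondTrue[OF p, of c1 t s' c2] run.CondFalse[OF p, of c2 t s' c1] r
    by (cases "holds s p") (simp_all only: if_True if_False not_True_eq_False not_False_eq_True True_implies_equals)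
  with Q show "wpt W (Cond p c1 c2) Q s" unfolding wpt_def by blast
qed

lemma wpt_mono: "wpt W c Q s \<Longrightarrow> (\<And>t s'. Q t s' \<Longrightarrow> Q' t s') \<Longrightarrow> wpt W c Q' s"
  unfolding wpt_def by blast

text \<open>Induction on the number of rounds still to go. The bound \<open>B\<close> may depend on
  the round: a uniform bound per bucket would multiply the worst bucket by \<open>2 * n\<close> and
  lose the quadratic time.\<close>

lemma wpt_While_counting:
  assumes init: "I 0 s"
    and test: "\<And>k s. k \<le> N \<Longrightarrow> I k s \<Longrightarrow> test_fits W s p \<and> (holds s p \<longleftrightarrow> k < N)"
    and body: "\<And>k s. k < N \<Longrightarrow> I k s \<Longrightarrow> wpt W c (\<lambda>t s'. t \<le> B k \<and> I (Suc k) s') s"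
  shows "wpt W (While p c)
    (\<lambda>t s'. t \<le> (\<Sum>k<N. test_cost p + 1 + B k) + test_cost p + 1 \<and> I N s') s"
proof -
  have "\<exists>t s'. run W (While p c) s t s' \<and>
      t \<le> (\<Sum>k=i..<N. test_cost p + 1 + B k) + test_cost p + 1 \<and> I N s'"
    if "i \<le> N" "I i s" for i s
    using that
  proof (induction i arbitrary: s rule: inc_induct)
    case base
    then show ?case using test[of N s] by (auto intro!: exI run.WhileFalse)
  next
    case (step i)
    from body[of i s] step obtain t1 s1
      where 1: "run W c s t1 s1" "t1 \<le> B i" "I (Suc i) s1"
      unfolding wpt_def by auto
    from step.IH[OF 1(3)] obtain t2 s2 where
      2: "run W (While p c) s1 t2 s2" "I N s2"
         "t2 \<le> (\<Sum>k=Suc i..<N. test_cost p + 1 + B k) + test_cost p + 1"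
      by auto
    have "run W (While p c) s (test_cost p + 1 + t1 + t2) s2"
      by (rule run.WhileTrue[OF _ _ 1(1) 2(1)]) (use test[of i s] step in auto)
    moreover have "(\<Sum>k=i..<N. test_cost p + 1 + B k) =
        (test_cost p + 1 + B i) + (\<Sum>k=Suc i..<N. test_cost p + 1 + B k)"
      using step by (simp add: sum.atLeast_Suc_lessThan)
    ultimately show ?case
      using 1 2 by (intro exI[of _ "test_cost p + 1 + t1 + t2"] exI[of _ s2]) auto
  qed
  from this[of 0 s] init show ?thesis
    unfolding wpt_def by (simp add: atLeast0LessThan)
qed

lemma wpt_While_bounded:
  assumes "I 0 s"
    and "\<And>k s. k \<le> N \<Longrightarrow> I k s \<Longrightarrow> test_fits W s p \<and> (holds s p \<longleftrightarrow> k < N)"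
    and "\<And>k s. k < N \<Longrightarrow> I k s \<Longrightarrow> wpt W c (\<lambda>t s'. t \<le> B \<and> I (Suc k) s') s"
  shows "wpt W (While p c) (\<lambda>t s'. t \<le> N * (test_cost p + 1 + B) + test_cost p + 1 \<and> I N s') s"
  using wpt_While_counting[of I s N W p c "\<lambda>_. B"] assms by simp

abbreviation var :: "string \<Rightarrow> expr" where "var x \<equiv> Cell x (Num 0)"
abbreviation set_var :: "string \<Rightarrow> expr \<Rightarrow> com" where "set_var x e \<equiv> Assign x (Num 0) e"
abbreviation incr :: "string \<Rightarrow> com" where "incr x \<equiv> set_var x (Add (var x) (Num 1))"

abbreviation equal_test :: "expr \<Rightarrow> expr \<Rightarrow> test" where
  "equal_test a b \<equiv> Conj (Neg (Less a b)) (Neg (Less b a))"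
abbreviation disj_test :: "test \<Rightarrow> test \<Rightarrow> test" where
  "disj_test p q \<equiv> Neg (Conj (Neg p) (Neg q))"


lemma common_edge_sym:
  assumes "common_edge E e f" shows "common_edge E f e"
proof -
  from assms obtain x u v where "x \<in> E - {e, f}" "u \<in> e" "v \<in> f" "x = {u, v}"
    unfolding common_edge_def by blast
  then have "x \<in> E - {f, e}" "x = {v, u}" by (auto simp: insert_commute)
  with \<open>u \<in> e\<close> \<open>v \<in> f\<close> show ?thesis unfolding common_edge_def by blast
qed


section \<open>Chains of arcs\<close>

abbreviation edge_of :: "'a \<times> 'a \<Rightarrow> 'a set" where
  "edge_of p \<equiv> {fst p, snd p}"

text \<open>The linear orders enter as numerical positions, which can be added in
  \<open>key\<close>. Nonadjacency means that the two position orders agree. Arcs only have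
  endpoints in \<open>\<Union>E\<close>, so this set takes the place of the vertex set.\<close>

locale permutation_diagram =
  fixes E :: "'a set set" and P1 P2 :: "'a \<Rightarrow> nat"
  assumes finite_edges: "finite E"
    and card_edge: "e \<in> E \<Longrightarrow> card e = 2"
    and edge_iff: "\<lbrakk>u \<in> \<Union>E; v \<in> \<Union>E; u \<noteq> v\<rbrakk> \<Longrightarrow> {u, v} \<in> E \<longleftrightarrow>
      \<not> (P1 u < P1 v \<and> P2 u < P2 v) \<and> \<not> (P1 v < P1 u \<and> P2 v < P2 u)"
begin

definition below :: "'a \<Rightarrow> 'a \<Rightarrow> bool" where
  "below u v \<longleftrightarrow> P1 u < P1 v \<and> P2 u < P2 v"

text \<open>
  An arc \<open>(c, l)\<close> is an edge with a chosen centre \<open>c\<close> of the star that contains it.  Arcs of the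
  same star are ordered by their leaves, arcs of different stars as wholes.
\<close>

definition prec :: "'a \<times> 'a \<Rightarrow> 'a \<times> 'a \<Rightarrow> bool" where
  "prec p q \<longleftrightarrow> below (snd p) (snd q) \<and> (fst p = fst q \<or>
     below (fst p) (fst q) \<and> below (fst p) (snd q) \<and> below (snd p) (fst q))"

definition key :: "'a \<times> 'a \<Rightarrow> nat" where
  "key p = P1 (fst p) + P1 (snd p)"

lemma below_trans: "below u v \<Longrightarrow> below v w \<Longrightarrow> below u w"
  unfolding below_def by simp

text \<open>In the mixed cases, where two of three arcs share a centre, the comparison of their
  leaves supplies the missing relation to the third arc.\<close>

lemma transp_prec: "transp prec"
  unfolding transp_def prec_def below_def by auto

lemma prec_key: "prec p q \<Longrightarrow> key p < key q"
  unfolding prec_def below_def key_def by auto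

lemma edge_neq: "{u, v} \<in> E \<Longrightarrow> u \<noteq> v"
  using card_edge by fastforce

lemma not_below: "{u, v} \<in> E \<Longrightarrow> \<not> below u v \<and> \<not> below v u"
  using edge_iff[of u v] edge_neq[of u v] unfolding below_def by blast

lemma below_or: "\<lbrakk>u \<in> \<Union>E; v \<in> \<Union>E; u \<noteq> v; {u, v} \<notin> E\<rbrakk> \<Longrightarrow> below u v \<or> below v u"
  using edge_iff[of u v] unfolding below_def by blast

text \<open>For \<open>u\<close> in \<open>p\<close> and \<open>v\<close> in \<open>q\<close>,
  \<open>prec\<close> gives \<open>below u v\<close>, except within a star: there
  \<open>u = v\<close> may be the centre, or \<open>{u, v}\<close> is one of the two edges
  themselves. No third edge is left.\<close>

lemma prec_compatible:
  assumes "prec p q" "edge_of p \<in> E" "edge_of q \<in> E"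
  shows "edge_of p \<noteq> edge_of q" "\<not> common_edge E (edge_of p) (edge_of q)"
    "\<not> common_edge E (edge_of q) (edge_of p)"
proof -
  obtain c l c' l' where pq: "p = (c, l)" "q = (c', l')"
    by (metis surj_pair)
  have irrefl: "\<not> below u u" for u unfolding below_def by simp
  show "edge_of p \<noteq> edge_of q"
    using assms irrefl not_below[of c l] unfolding prec_def pq by (auto simp: doubleton_eq_iff)
  have main: "{u, v} \<notin> E - {edge_of p, edge_of q}" if "u \<in> edge_of p" "v \<in> edge_of q" for u v
  proof (cases "below u v \<or> u = v")
    case True
    then show ?thesis using not_below[of u v] edge_neq[of u v] by blast
  next
    case False
    then have "{u, v} = edge_of p \<or> {u, v} = edge_of q"
      using assms(1) that unfolding prec_def pq by (auto simp: doubleton_eq_iff)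
    then show ?thesis by blast
  qed
  show "\<not> common_edge E (edge_of p) (edge_of q)"
    using main unfolding common_edge_def by blast
  then show "\<not> common_edge E (edge_of q) (edge_of p)"
    using common_edge_sym by blast
qed

text \<open>The list is decreasing because the program emits a chain from its last arc backwards.
  Comparable arcs have different underlying edges, so no edge occurs in both orientations and the
  count is exact.\<close>

lemma packing_of_chain:
  assumes chain: "sorted_wrt (\<lambda>p q. prec q p) ps" and arcs: "\<And>p. p \<in> set ps \<Longrightarrow> edge_of p \<in> E"
  shows "edge_open_packing E (edge_of ` set ps)" "card (edge_of ` set ps) = length ps"
proof -
  have cmp: "prec (ps ! j) (ps ! i)" if "i < j" "j < length ps" for i j
    using sorted_wrt_nth_less[OF chain] that by blast
  have neq: "edge_of (ps ! i) \<noteq> edge_of (ps ! j) \<and>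
      \<not> common_edge E (edge_of (ps ! i)) (edge_of (ps ! j))"
    if ij: "i < length ps" "j < length ps" "i \<noteq> j" for i j
  proof -
    have arc: "edge_of (ps ! i) \<in> E" "edge_of (ps ! j) \<in> E" using arcs that by auto
    consider "prec (ps ! i) (ps ! j)" | "prec (ps ! j) (ps ! i)"
      using cmp[of i j] cmp[of j i] ij by (meson linorder_neqE_nat)
    then show ?thesis
    proof cases
      case 1 then show ?thesis using prec_compatible[OF 1 arc] by blast
    next
      case 2 then show ?thesis using prec_compatible[OF 2 arc(2,1)] by metis
    qed
  qed
  show "edge_open_packing E (edge_of ` set ps)"
    unfolding edge_open_packing_def
  proof (intro conjI ballI impI)
    show "edge_of ` set ps \<subseteq> E" using arcs by auto
  next
    fix e f assume "e \<in> edge_of ` set ps" "f \<in> edge_of ` set ps" "e \<noteq> f"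
    then obtain p q where "p \<in> set ps" "q \<in> set ps" and ef: "e = edge_of p" "f = edge_of q"
      by blast
    then obtain i j where ij: "i < length ps" "j < length ps" "p = ps ! i" "q = ps ! j"
      by (metis in_set_conv_nth)
    then have "i \<noteq> j" using \<open>e \<noteq> f\<close> ef by blast
    with neq[of i j] ij ef show "\<not> common_edge E e f" by auto
  qed
  have "distinct (map edge_of ps)"
    unfolding distinct_conv_nth using neq by auto
  then show "card (edge_of ` set ps) = length ps"
    using distinct_card[of "map edge_of ps"] by simp
qed

text \<open>If other packed edges met both ends of \<open>e\<close>, then \<open>e\<close> itself
  would be a common edge of two of them. So one end is free and becomes the leaf; for an edge that
  meets no other, either end will do.\<close>

lemma star_center:
  assumes D: "edge_open_packing E D" and e: "e \<in> D"
  shows "\<exists>p. e = edge_of p \<and> (\<forall>f\<in>D. f \<noteq> e \<longrightarrow> e \<inter> f \<subseteq> {fst p})"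
proof -
  from D e have eE: "e \<in> E" unfolding edge_open_packing_def by auto
  then obtain a b where ab: "e = {a, b}" "a \<noteq> b"
    using card_edge by (meson card_2_iff)
  have "\<not> (a \<in> f \<and> b \<in> g)" if "f \<in> D" "g \<in> D" "f \<noteq> e" "g \<noteq> e" for f g
  proof
    assume in_fg: "a \<in> f \<and> b \<in> g"
    \<comment> \<open>A single edge through both \<open>a\<close> and \<open>b\<close> would be
      \<open>e\<close>.\<close>
    have "f \<noteq> g"
    proof
      assume "f = g"
      moreover have "card f = 2" using D that card_edge unfolding edge_open_packing_def by auto
      ultimately have "e = f"
        using in_fg ab by (auto intro!: card_subset_eq simp: card_2_iff)
      with that show False by simp
    qed
    moreover have "common_edge E f g"
      unfolding common_edge_def using eE that in_fg ab by (intro bexI[of _ e]) auto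
    ultimately show False using D that unfolding edge_open_packing_def by auto
  qed
  then consider "\<forall>f\<in>D. f \<noteq> e \<longrightarrow> a \<notin> f" | "\<forall>f\<in>D. f \<noteq> e \<longrightarrow> b \<notin> f"
    by blast
  then show ?thesis
  proof cases
    case 1 then show ?thesis using ab by (intro exI[of _ "(b, a)"]) auto
  next
    case 2 then show ?thesis using ab by (intro exI[of _ "(a, b)"]) auto
  qed
qed

text \<open>All four cross pairs are comparable. Once the centres are ordered, a cross pair in the
  opposite order would by transitivity make the two ends of one edge comparable, against
  \<open>not_below\<close>.\<close>

lemma separated_edges_prec:
  assumes e: "{c, l} \<in> E" and f: "{c', l'} \<in> E"
    and sep: "\<And>u v. u \<in> {c, l} \<Longrightarrow> v \<in> {c', l'} \<Longrightarrow> u \<noteq> v \<and> {u, v} \<notin> E"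
  shows "prec (c, l) (c', l') \<or> prec (c', l') (c, l)"
proof -
  have cmp: "below u v \<or> below v u" if "u \<in> {c, l}" "v \<in> {c', l'}" for u v
    using that e f sep[of u v] below_or[of u v] by blast
  note n = not_below[OF e] not_below[OF f]
  show ?thesis
  proof (cases "below c c'")
    case True
    then have "below c l'" "below l c'"
      using n cmp[of c l'] cmp[of l c'] below_trans by blast+
    moreover from this have "below l l'"
      using n cmp[of l l'] below_trans by blast
    ultimately show ?thesis using True unfolding prec_def by simp
  next
    case False
    then have "below c' c" using cmp[of c c'] by blast
    moreover from this have "below c' l" "below l' c"
      using n cmp[of c l'] cmp[of l c'] below_trans by blast+
    moreover from this have "below l' l"
      using n cmp[of l l'] below_trans by blast
    ultimately show ?thesis unfolding prec_def by simp
  qed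
qed

lemma chain_of_packing:
  assumes D: "edge_open_packing E D"
  obtains ar where "\<And>e. e \<in> D \<Longrightarrow> e = edge_of (ar e)"
    "\<And>e f. e \<in> D \<Longrightarrow> f \<in> D \<Longrightarrow> e \<noteq> f \<Longrightarrow> prec (ar e) (ar f) \<or> prec (ar f) (ar e)"
proof -
  have "\<forall>e\<in>D. \<exists>p. e = edge_of p \<and> (\<forall>f\<in>D. f \<noteq> e \<longrightarrow> e \<inter> f \<subseteq> {fst p})"
    using star_center[OF D] by blast
  from bchoice[OF this] obtain ar where
    ar: "\<And>e. e \<in> D \<Longrightarrow> e = edge_of (ar e)"
    and center: "\<And>e f. e \<in> D \<Longrightarrow> f \<in> D \<Longrightarrow> f \<noteq> e \<Longrightarrow> e \<inter> f \<subseteq> {fst (ar e)}"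
    by metis
  have "prec (ar e) (ar f) \<or> prec (ar f) (ar e)" if ef: "e \<in> D" "f \<in> D" "e \<noteq> f" for e f
  proof -
    obtain c l c' l' where a: "ar e = (c, l)" "ar f = (c', l')" by (metis surj_pair)
    have e: "e = {c, l}" and f: "f = {c', l'}" using ar[OF ef(1)] ar[OF ef(2)] a by auto
    have E: "{c, l} \<in> E" "{c', l'} \<in> E"
      using D ef e f unfolding edge_open_packing_def by auto
    have no: "{u, v} \<notin> E - {e, f}" if "u \<in> e" "v \<in> f" for u v
      using D ef that unfolding edge_open_packing_def common_edge_def by blast
    \<comment> \<open>The centres are chosen edge by edge. A common vertex of two packed edges must
      equal both choices, so the choices agree within a star.\<close>
    have sub: "e \<inter> f \<subseteq> {c}" "e \<inter> f \<subseteq> {c'}"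
      using center[OF ef(1,2)] center[OF ef(2,1)] ef a by auto
    show ?thesis
    proof (cases "c = c'")
      case True
      have "c \<noteq> l" "c' \<noteq> l'" "l \<noteq> l'" using E edge_neq ef e f True by auto
      \<comment> \<open>An edge between the leaves would be a third edge joining \<open>e\<close>
        and \<open>f\<close>.\<close>
      then have "{l, l'} \<notin> E"
        using no[of l l'] e f True by (auto simp: doubleton_eq_iff)
      then have "below l l' \<or> below l' l"
        using below_or[of l l'] \<open>l \<noteq> l'\<close> E by blast
      then show ?thesis using True unfolding a prec_def by auto
    next
      case False
      then have "e \<inter> f = {}" using sub by blast
      then have "u \<noteq> v \<and> {u, v} \<notin> E" if "u \<in> {c, l}" "v \<in> {c', l'}" for u v
        using no[of u v] that e f by blast
      then show ?thesis unfolding a by (rule separated_edges_prec[OF E])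
    qed
  qed
  with ar show ?thesis by (rule that)
qed

text \<open>A strictly monotone function is injective on a chain; applied to the table of the dynamic program.\<close>

lemma card_packing_le:
  fixes h :: "'a \<times> 'a \<Rightarrow> nat"
  assumes D: "edge_open_packing E D"
    and mono: "\<And>p q. edge_of p \<in> E \<Longrightarrow> edge_of q \<in> E \<Longrightarrow> prec p q \<Longrightarrow> h p < h q"
    and bound: "\<And>p. edge_of p \<in> E \<Longrightarrow> 1 \<le> h p \<and> h p \<le> L"
  shows "card D \<le> L"
proof -
  from chain_of_packing[OF D] obtain ar where
    ar: "\<And>e. e \<in> D \<Longrightarrow> e = edge_of (ar e)"
    and cmp: "\<And>e f. e \<in> D \<Longrightarrow> f \<in> D \<Longrightarrow> e \<noteq> f \<Longrightarrow> prec (ar e) (ar f) \<or> prec (ar f) (ar e)"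
    by (rule chain_of_packing[OF D]) blast
  have E: "edge_of (ar e) \<in> E" if "e \<in> D" for e
    using D that ar[OF that] unfolding edge_open_packing_def by auto
  have "inj_on (h \<circ> ar) D"
  proof (rule inj_onI, rule ccontr)
    fix e f assume "e \<in> D" "f \<in> D" "(h \<circ> ar) e = (h \<circ> ar) f" "e \<noteq> f"
    then show False using cmp[of e f] mono[OF E E, of e f] mono[OF E E, of f e] by auto
  qed
  then have "card D = card ((h \<circ> ar) ` D)" by (rule card_image[symmetric])
  also have "\<dots> \<le> card {1..L}"
    by (rule card_mono) (use bound[OF E] in auto)
  finally show ?thesis by simp
qed

lemma edge_open_packing_number_eq:
  assumes "edge_open_packing E D" "\<And>D'. edge_open_packing E D' \<Longrightarrow> card D' \<le> card D"
  shows "edge_open_packing_number E = card D"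
  unfolding edge_open_packing_number_def
proof (rule Max_eqI)
  have "{D. edge_open_packing E D} \<subseteq> Pow E" unfolding edge_open_packing_def by auto
  then show "finite (card ` {D. edge_open_packing E D})"
    using finite_edges by (meson finite_Pow_iff finite_imageI finite_subset)
qed (use assms in auto)

end


section \<open>The program\<close>

abbreviation below_test :: "expr \<Rightarrow> expr \<Rightarrow> test" where
  "below_test a b \<equiv> Conj (Less (Cell ''pos1'' a) (Cell ''pos1'' b)) (Less (Cell ''pos2'' a) (Cell ''pos2'' b))"

definition prec_test :: "expr \<Rightarrow> expr \<Rightarrow> test" where
  "prec_test p q =
     (let c = Cell ''center'' p; l = Cell ''leaf'' p; c' = Cell ''center'' q; l' = Cell ''leaf'' q
      in Conj (below_test l l') (disj_test (equal_test c c')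
           (Conj (below_test c c') (Conj (below_test c l') (below_test l c')))))"

abbreviation below_double :: "string \<Rightarrow> string \<Rightarrow> test" where
  "below_double x y \<equiv> Less (var x) (Add (var y) (var y))"

text \<open>The number 9 is the cost 8 of the test plus one unit for the loop command.\<close>

lemma wpt_While_below_double:
  assumes "I 0 s"
    and "\<And>k s. k \<le> 2 * N \<Longrightarrow> I k s \<Longrightarrow> s x 0 = k \<and> s y 0 = N" "2 * N \<le> W"
    and "\<And>k s. k < 2 * N \<Longrightarrow> I k s \<Longrightarrow> wpt W c (\<lambda>t s'. t \<le> B k \<and> I (Suc k) s') s"
  shows "wpt W (While (below_double x y) c)
    (\<lambda>t s'. t \<le> (\<Sum>k<2 * N. 9 + B k) + 9 \<and> I (2 * N) s') s"
proof -
  have "test_fits W s (below_double x y) \<and> (holds s (below_double x y) \<longleftrightarrow> k < 2 * N)"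
    if "k \<le> 2 * N" "I k s" for k s
    using assms(2)[OF that] that(1) assms(3) by auto
  note loop = wpt_While_counting[where I = I, OF assms(1) this assms(4)]
  have "test_cost (below_double x y) = 8" by simp
  then show ?thesis by (intro wpt_mono[OF loop]) (simp_all del: test_cost.simps)
qed

definition compute_positions :: com where
  "compute_positions = Seq (set_var ''i'' (Num 0)) (While (Less (var ''i'') (var ''n''))
     (Seq (Assign ''pos1'' (Cell ''order1'' (var ''i'')) (var ''i''))
     (Seq (Assign ''pos2'' (Cell ''order2'' (var ''i'')) (var ''i''))
          (incr ''i''))))"

definition compute_arcs :: com where
  "compute_arcs = Seq (set_var ''i'' (Num 0)) (While (Less (var ''i'') (var ''m''))
     (Seq (Assign ''center'' (var ''i'') (Cell ''edge_fst'' (var ''i'')))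
     (Seq (Assign ''leaf'' (var ''i'') (Cell ''edge_snd'' (var ''i'')))
     (Seq (Assign ''center'' (Add (var ''m'') (var ''i'')) (Cell ''edge_snd'' (var ''i'')))
     (Seq (Assign ''leaf'' (Add (var ''m'') (var ''i'')) (Cell ''edge_fst'' (var ''i'')))
          (incr ''i''))))))"

definition relax :: com where
  "relax = Seq
     (Cond (Conj (prec_test (var ''q'') (var ''p''))
                 (Neg (Less (Cell ''len'' (var ''q'')) (Cell ''len'' (var ''p'')))))
        (Seq (Assign ''len'' (var ''p'') (Add (Cell ''len'' (var ''q'')) (Num 1)))
             (Assign ''pred'' (var ''p'') (var ''q'')))
        Skip)
     (incr ''q'')"

definition process_arc :: com where
  "process_arc = Seq (Assign ''len'' (var ''p'') (Num 1)) (Seq (set_var ''q'' (Num 0))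
     (While (below_double ''q'' ''m'') relax))"

definition scan_arc :: com where
  "scan_arc = Seq
     (Cond (equal_test (Add (Cell ''pos1'' (Cell ''center'' (var ''p'')))
                            (Cell ''pos1'' (Cell ''leaf'' (var ''p'')))) (var ''k''))
        process_arc Skip)
     (incr ''p'')"

text \<open>Arcs with equal keys are incomparable under \<open>prec\<close>, so their order within a
  bucket does not matter.\<close>

definition process_bucket :: com where
  "process_bucket = Seq (set_var ''p'' (Num 0)) (Seq
     (While (below_double ''p'' ''m'') scan_arc)
     (incr ''k''))"

definition compute_chains :: com where
  "compute_chains = Seq (set_var ''k'' (Num 0))
     (While (below_double ''k'' ''n'') process_bucket)"

definition find_best :: com where
  "find_best = Seq (set_var ''best'' (Num 0)) (Seq (set_var ''p'' (Num 0))
     (While (below_double ''p'' ''m'')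
       (Seq (Cond (Less (Cell ''len'' (var ''best'')) (Cell ''len'' (var ''p'')))
              (set_var ''best'' (var ''p'')) Skip)
            (incr ''p''))))"

definition output_chain :: com where
  "output_chain = Seq (set_var ''p'' (var ''best'')) (Seq (set_var ''out_size'' (Num 0))
     (Seq (set_var ''total'' (Cell ''len'' (var ''best'')))
     (While (Less (var ''out_size'') (var ''total''))
       (Seq (Assign ''out_fst'' (var ''out_size'') (Cell ''center'' (var ''p'')))
       (Seq (Assign ''out_snd'' (var ''out_size'') (Cell ''leaf'' (var ''p'')))
       (Seq (set_var ''p'' (Cell ''pred'' (var ''p'')))
            (incr ''out_size'')))))))"

definition packing_program :: com where
  "packing_program = Seq compute_positions (Seq compute_arcs (Seq compute_chains
     (Seq find_best output_chain)))"

lemmas wpt_simps = wpt_Skip wpt_Assign wpt_Seq wpt_Cond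


section \<open>The dynamic program\<close>

text \<open>The bound on \<open>W\<close> leaves room for the sum of two positions, for arc indices
  up to \<open>2 * m\<close>, and for a length plus 1, which is at most
  \<open>2 * n + 1\<close>.\<close>

locale arc_program = permutation_diagram E P1 P2
  for E :: "nat set set" and P1 P2 :: "nat \<Rightarrow> nat" +
  fixes n m W :: nat and arcs :: "(nat \<times> nat) list"
  assumes length_arcs: "length arcs = 2 * m"
    and set_arcs: "set arcs = {p. edge_of p \<in> E}"
    and arcs_less: "\<And>p. p < 2 * m \<Longrightarrow> fst (arcs ! p) < n \<and> snd (arcs ! p) < n"
    and positions_less: "\<And>v. v < n \<Longrightarrow> P1 v < n \<and> P2 v < n"
    and word: "4 * n + 4 * m + 4 \<le> W"
begin

text \<open>These are the data that no phase after the preprocessing overwrites;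
  \<open>env_upd\<close> carries them across assignments to other arrays.\<close>

definition env :: "mem \<Rightarrow> bool" where
  "env s \<longleftrightarrow> s ''n'' 0 = n \<and> s ''m'' 0 = m \<and>
     (\<forall>v<n. s ''pos1'' v = P1 v \<and> s ''pos2'' v = P2 v) \<and>
     (\<forall>p<2*m. s ''center'' p = fst (arcs ! p) \<and> s ''leaf'' p = snd (arcs ! p))"

lemma env_upd [simp]:
  "x \<notin> {''n'', ''m'', ''pos1'', ''pos2'', ''center'', ''leaf''} \<Longrightarrow> env (s(x := f)) \<longleftrightarrow> env s"
  unfolding env_def by auto

definition arc_prec :: "nat \<Rightarrow> nat \<Rightarrow> bool" where
  "arc_prec q p \<longleftrightarrow> prec (arcs ! q) (arcs ! p)"

definition arc_key :: "nat \<Rightarrow> nat" where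
  "arc_key p = key (arcs ! p)"

lemma arc_prec_key: "arc_prec q p \<Longrightarrow> arc_key q < arc_key p"
  unfolding arc_prec_def arc_key_def by (rule prec_key)

lemma arc_key_less: "p < 2 * m \<Longrightarrow> arc_key p < 2 * n"
  using arcs_less[of p] positions_less[of "fst (arcs ! p)"] positions_less[of "snd (arcs ! p)"]
  unfolding arc_key_def key_def by simp

lemma env_prec_test:
  assumes "env s" "s x 0 < 2 * m" "s y 0 < 2 * m"
  shows "holds s (prec_test (var x) (var y)) \<longleftrightarrow> arc_prec (s x 0) (s y 0)"
    "test_fits W s (prec_test (var x) (var y))"
proof -
  let ?p = "s x 0" let ?q = "s y 0"
  have c: "s ''center'' ?p = fst (arcs ! ?p)" "s ''leaf'' ?p = snd (arcs ! ?p)"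
    "s ''center'' ?q = fst (arcs ! ?q)" "s ''leaf'' ?q = snd (arcs ! ?q)"
    using assms unfolding env_def by auto
  have pos: "s ''pos1'' v = P1 v" "s ''pos2'' v = P2 v" "v \<le> W" "P1 v \<le> W" "P2 v \<le> W"
    if "v \<in> {fst (arcs ! ?p), snd (arcs ! ?p), fst (arcs ! ?q), snd (arcs ! ?q)}" for v
    using that assms(1) arcs_less[OF assms(2)] arcs_less[OF assms(3)] positions_less[of v] word
    unfolding env_def by auto
  show "holds s (prec_test (var x) (var y)) \<longleftrightarrow> arc_prec ?p ?q"
    unfolding prec_test_def arc_prec_def prec_def below_def
    by (auto simp: Let_def c pos)
  show "test_fits W s (prec_test (var x) (var y))"
    unfolding prec_test_def using assms word by (simp add: Let_def c pos)
qed

text \<open>A local certificate instead of a maximum over chains: the inequality over predecessors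
  gives the strict monotonicity behind the upper bound, and the last conjunct lets a chain of that
  length be traced back. The bound by \<open>arc_key\<close>, valid since keys increase strictly
  along a chain, keeps lengths within a word.\<close>

definition good :: "(nat \<Rightarrow> nat) \<Rightarrow> (nat \<Rightarrow> nat) \<Rightarrow> nat \<Rightarrow> bool" where
  "good L R p \<longleftrightarrow> 1 \<le> L p \<and> L p \<le> arc_key p + 1 \<and>
     (\<forall>q<2*m. arc_prec q p \<longrightarrow> L q + 1 \<le> L p) \<and>
     (L p = 1 \<or> R p < 2 * m \<and> arc_prec (R p) p \<and> L (R p) + 1 = L p)"

text \<open>
  Unprocessed cells are 0: so \<open>len\<close> is bounded everywhere it is read, and without edges the best chain
  found, at the junk index 0, has length 0.
\<close>

definition table :: "nat set \<Rightarrow> (nat \<Rightarrow> nat) \<Rightarrow> (nat \<Rightarrow> nat) \<Rightarrow> bool" where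
  "table S L R \<longleftrightarrow> (\<forall>p. (p \<in> S \<longrightarrow> good L R p) \<and> (p \<notin> S \<longrightarrow> L p = 0)) \<and> (\<forall>p. R p \<le> 2 * m)"

lemma table_bound: "table S L R \<Longrightarrow> L p \<le> arc_key p + 1"
  unfolding table_def good_def by (metis le0)

text \<open>A later arc has no smaller key than an earlier one, so it is not among its predecessors
  and cannot invalidate its certificate.\<close>

lemma table_insert:
  assumes "table S L R" "p < 2 * m" "p \<notin> S"
    and "\<And>r. r \<in> S \<Longrightarrow> arc_key r \<le> arc_key p"
    and "good (L(p := a)) (R(p := b)) p" "b \<le> 2 * m"
  shows "table (insert p S) (L(p := a)) (R(p := b))"
proof -
  have "good (L(p := a)) (R(p := b)) r" if r: "r \<in> S" for r
  proof -
    have "r \<noteq> p" "\<not> arc_prec p r" using assms(3) assms(4)[of r] r arc_prec_key[of p r] by auto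
    moreover have "good L R r" using assms(1) r unfolding table_def by blast
    ultimately show ?thesis unfolding good_def by auto
  qed
  with assms show ?thesis unfolding table_def by auto
qed

lemma process_arc:
  assumes env: "env s" and p: "s ''p'' 0 = p" "p < 2 * m" "p \<notin> S"
    and S: "\<And>r. r \<in> S \<Longrightarrow> arc_key r \<le> arc_key p" "\<And>r. r < 2 * m \<Longrightarrow> arc_prec r p \<Longrightarrow> r \<in> S"
    and tab: "table S (s ''len'') (s ''pred'')" and k: "s ''k'' 0 = k"
  shows "wpt W process_arc (\<lambda>t s'. t \<le> 2 * m * 1000 + 1000 \<and> env s' \<and> s' ''p'' 0 = p \<and>
    s' ''k'' 0 = k \<and> table (insert p S) (s' ''len'') (s' ''pred'')) s"
proof -
  define L R where "L = s ''len''" and "R = s ''pred''"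
  have tab: "table S L R" using tab unfolding L_def R_def .
  define J where "J j a b s' \<longleftrightarrow> env s' \<and> s' ''p'' 0 = p \<and> s' ''k'' 0 = k \<and> s' ''q'' 0 = j \<and>
    s' ''len'' = L(p := a) \<and> s' ''pred'' = R(p := b)" for j a b and s' :: mem
  \<comment> \<open>The value \<open>a\<close> is the best length over the first \<open>j\<close>
    candidates, where 1 stands for the chain consisting of \<open>p\<close> alone.\<close>
  define C where "C j a b \<longleftrightarrow> 1 \<le> a \<and> a \<le> arc_key p + 1 \<and>
      b \<le> 2 * m \<and> (\<forall>r<j. arc_prec r p \<longrightarrow> L r + 1 \<le> a) \<and>
      (a = 1 \<or> b < 2 * m \<and> arc_prec b p \<and> L b + 1 = a)" for j a b
  define I where "I j s' \<longleftrightarrow> (\<exists>a b. J j a b s' \<and> C j a b)" for j s'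
  have nm: "s' ''n'' 0 = n" "s' ''m'' 0 = m" if "env s'" for s'
    using that unfolding env_def by auto
  have irrefl: "\<not> arc_prec p p" using arc_prec_key[of p p] by auto
  have loop: "wpt W (While (below_double ''q'' ''m'') relax)
      (\<lambda>t s'. t \<le> (\<Sum>k<2 * m. 9 + 500) + 9 \<and> I (2 * m) s') s'" if "I 0 s'" for s'
  proof (rule wpt_While_below_double[where I = I and B = "\<lambda>_. 500"], fact that)
    fix j s' assume "I j s'"
    then show "s' ''q'' 0 = j \<and> s' ''m'' 0 = m" using nm unfolding I_def J_def by blast
  next
    show "2 * m \<le> W" using word by simp
  next
    fix j s' assume j: "j < 2 * m" and "I j s'"
    then obtain a b where J: "J j a b s'" and C: "C j a b" unfolding I_def by blast
    have s': "env s'" "s' ''p'' 0 = p" "s' ''k'' 0 = k" "s' ''q'' 0 = j"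
      "s' ''len'' = L(p := a)" "s' ''pred'' = R(p := b)"
      using J unfolding J_def by blast+
    have bounds: "L j + 1 \<le> W" "a + 1 \<le> W" "j + 1 \<le> W" "p \<le> W" "1 \<le> W" "L j \<le> W" "a \<le> W" "j \<le> W"
      using table_bound[OF tab, of j] C arc_key_less[OF j] arc_key_less[OF p(2)] word j p
      unfolding C_def by auto
    have test: "holds s' (prec_test (var ''q'') (var ''p'')) \<longleftrightarrow> arc_prec j p"
      "test_fits W s' (prec_test (var ''q'') (var ''p''))"
      using env_prec_test[of s' "''q''" "''p''"] s' j p by auto
    have cost: "test_cost (prec_test (var ''q'') (var ''p'')) \<le> 300"
      unfolding prec_test_def by (simp add: Let_def)
    show "wpt W relax (\<lambda>t s'. t \<le> 500 \<and> I (Suc j) s') s'"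
    proof (cases "arc_prec j p \<and> a \<le> L j")
      case True
      \<comment> \<open>The key bound survives because \<open>L j\<close> is at most
        \<open>arc_key j + 1\<close>, which is at most \<open>arc_key p\<close>.\<close>
      then have "C (Suc j) (L j + 1) j"
        using table_bound[OF tab, of j] arc_prec_key[of j p] j C
        unfolding C_def less_Suc_eq by fastforce
      \<comment> \<open>While \<open>p\<close> is processed its own cell already holds
        \<open>a\<close>; only for \<open>j\<close> different from \<open>p\<close> is the value
        read equal to \<open>L j\<close>.\<close>
      moreover have "j \<noteq> p" using True irrefl by auto
      then have "wpt W relax (\<lambda>t s'. t \<le> 500 \<and> J (Suc j) (L j + 1) j s') s'"
        unfolding relax_def using True test cost s' bounds by (simp add: wpt_simps J_def)
      ultimately show ?thesis unfolding I_def by (elim wpt_mono) blast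
    next
      case False
      then have "C (Suc j) a b" using C unfolding C_def less_Suc_eq by auto
      moreover have "wpt W relax (\<lambda>t s'. t \<le> 500 \<and> J (Suc j) a b s') s'"
        unfolding relax_def using False test cost s' bounds irrefl by (auto simp: wpt_simps J_def)
      ultimately show ?thesis unfolding I_def by (elim wpt_mono) blast
    qed
  qed
  \<comment> \<open>The predecessor is not initialised: \<open>b\<close> starts as whatever is
    stored, which is harmless while the length is 1.\<close>
  have "J 0 1 (R p) (s(''len'' := L(p := 1), ''q'' := (s ''q'')(0 := 0)))"
    using env p k unfolding J_def L_def R_def by auto
  moreover have "C 0 1 (R p)" using tab unfolding C_def table_def by simp
  ultimately have start: "I 0 (s(''len'' := L(p := 1), ''q'' := (s ''q'')(0 := 0)))"
    unfolding I_def by blast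
  have final: "table (insert p S) (s' ''len'') (s' ''pred'')" if "I (2 * m) s'" for s'
  proof -
    from that obtain a b where J: "J (2 * m) a b s'" and C: "C (2 * m) a b" unfolding I_def by blast
    have "good (L(p := a)) (R(p := b)) p"
      using C irrefl unfolding good_def C_def by auto
    then show ?thesis
      using J C table_insert[OF tab p(2,3) S(1)] unfolding J_def C_def by simp
  qed
  \<comment> \<open>The 7 units pay for the two assignments before the loop, 4 for
    \<open>len\<close> and 3 for \<open>q\<close>.\<close>
  have "wpt W (While (below_double ''q'' ''m'') relax)
    (\<lambda>t s'. t + 7 \<le> 2 * m * 1000 + 1000 \<and> env s' \<and> s' ''p'' 0 = p \<and> s' ''k'' 0 = k \<and>
      table (insert p S) (s' ''len'') (s' ''pred'')) (s(''len'' := L(p := 1), ''q'' := (s ''q'')(0 := 0)))"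
    by (rule wpt_mono[OF loop[OF start]]) (use final in \<open>auto simp: I_def J_def\<close>)
  then show ?thesis
    using p k word unfolding process_arc_def
    by (simp add: wpt_Seq wpt_Assign flip: L_def)
qed

section \<open>Scanning the arcs in buckets, and the amortised cost\<close>

definition scanned :: "nat \<Rightarrow> nat \<Rightarrow> nat set" where
  "scanned k i = {r. r < 2 * m \<and> (arc_key r < k \<or> arc_key r = k \<and> r < i)}"

text \<open>The end of one bucket is the start of the next, and \<open>2 * n\<close> buckets suffice
  because every key is below \<open>2 * n\<close>.\<close>

lemma scanned_simps:
  "scanned 0 0 = {}" "scanned k (2 * m) = scanned (Suc k) 0" "scanned (2 * n) 0 = {..<2 * m}"
  using arc_key_less unfolding scanned_def by auto

lemma scanned_Suc:
  "scanned k (Suc i) = (if i < 2 * m \<and> arc_key i = k then insert i (scanned k i) else scanned k i)"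
  unfolding scanned_def by (auto simp: less_Suc_eq)

definition scan_inv :: "nat \<Rightarrow> nat \<Rightarrow> mem \<Rightarrow> bool" where
  "scan_inv k i s \<longleftrightarrow> env s \<and> s ''k'' 0 = k \<and> s ''p'' 0 = i \<and>
     table (scanned k i) (s ''len'') (s ''pred'')"

definition scan_cost :: "nat \<Rightarrow> nat \<Rightarrow> nat" where
  "scan_cost k i = 50 + (if arc_key i = k then 2 * m * 1000 + 1000 else 0)"

lemma scan_arc:
  assumes k: "k < 2 * n" and i: "i < 2 * m" and inv: "scan_inv k i s"
  shows "wpt W scan_arc (\<lambda>t s'. t \<le> scan_cost k i \<and> scan_inv k (Suc i) s') s"
proof -
  let ?c = "fst (arcs ! i)" let ?l = "snd (arcs ! i)"
  have s: "env s" "s ''k'' 0 = k" "s ''p'' 0 = i" "table (scanned k i) (s ''len'') (s ''pred'')"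
    using inv unfolding scan_inv_def by auto
  have cl: "?c < n" "?l < n" "P1 ?c < n" "P1 ?l < n"
    using arcs_less[OF i] positions_less by auto
  have cells: "s ''center'' i = ?c" "s ''leaf'' i = ?l" "s ''pos1'' ?c = P1 ?c" "s ''pos1'' ?l = P1 ?l"
    using s(1) i cl unfolding env_def by auto
  have key: "P1 ?c + P1 ?l = arc_key i" unfolding arc_key_def key_def by simp
  show ?thesis
  proof (cases "arc_key i = k")
    case True
    have "i \<notin> scanned k i" "\<And>r. r \<in> scanned k i \<Longrightarrow> arc_key r \<le> arc_key i"
      using True unfolding scanned_def by auto
    moreover have "\<And>r. r < 2 * m \<Longrightarrow> arc_prec r i \<Longrightarrow> r \<in> scanned k i"
      using True arc_prec_key unfolding scanned_def by auto
    ultimately have "wpt W process_arc (\<lambda>t s'. t \<le> 2 * m * 1000 + 1000 \<and> env s' \<and> s' ''p'' 0 = i \<and>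
        s' ''k'' 0 = k \<and> table (insert i (scanned k i)) (s' ''len'') (s' ''pred'')) s"
      by (intro process_arc s i) auto
    then show ?thesis
      unfolding scan_arc_def using s cells key cl word i k True
      by (simp add: wpt_simps scan_inv_def scan_cost_def scanned_Suc)
        (erule wpt_mono, simp add: wpt_simps)
  next
    case False
    then show ?thesis
      unfolding scan_arc_def using s cells key cl word i k
      by (auto simp: wpt_simps scan_inv_def scan_cost_def scanned_Suc)
  qed
qed

definition bucket_cost :: "nat \<Rightarrow> nat" where
  "bucket_cost k = (\<Sum>i<2 * m. 9 + scan_cost k i) + 50"

definition bucket_inv :: "nat \<Rightarrow> mem \<Rightarrow> bool" where
  "bucket_inv k s \<longleftrightarrow> env s \<and> s ''k'' 0 = k \<and> table (scanned k 0) (s ''len'') (s ''pred'')"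

lemma env_sizes: "env s \<Longrightarrow> s ''n'' 0 = n" "env s \<Longrightarrow> s ''m'' 0 = m"
  unfolding env_def by auto

lemma process_bucket:
  assumes k: "k < 2 * n" and inv: "bucket_inv k s"
  shows "wpt W process_bucket (\<lambda>t s'. t \<le> bucket_cost k \<and> bucket_inv (Suc k) s') s"
proof -
  have "scan_inv k 0 (s(''p'' := (s ''p'')(0 := 0)))"
    using inv unfolding bucket_inv_def scan_inv_def by simp
  then have "wpt W (While (below_double ''p'' ''m'') scan_arc)
      (\<lambda>t s'. t \<le> (\<Sum>i<2 * m. 9 + scan_cost k i) + 9 \<and> scan_inv k (2 * m) s')
      (s(''p'' := (s ''p'')(0 := 0)))"
    by (rule wpt_While_below_double[where I = "scan_inv k" and B = "scan_cost k"])
      (use scan_arc[OF k] word env_sizes in \<open>auto simp: scan_inv_def\<close>)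
  then have "wpt W (While (below_double ''p'' ''m'') scan_arc)
      (\<lambda>t s'. t + 9 \<le> bucket_cost k \<and> env s' \<and> s' ''k'' 0 = k \<and> Suc (s' ''k'' 0) \<le> W \<and>
        table (scanned (Suc k) 0) (s' ''len'') (s' ''pred'')) (s(''p'' := (s ''p'')(0 := 0)))"
    by (rule wpt_mono) (use k word in \<open>auto simp: bucket_cost_def scan_inv_def scanned_simps\<close>)
  then show ?thesis
    unfolding process_bucket_def using word
    by (simp add: wpt_Seq wpt_Assign bucket_inv_def) (erule wpt_mono, simp add: wpt_simps)
qed

text \<open>After exchanging the sums, each arc pays the expensive term for exactly one
  \<open>k\<close>, which gives the terms in \<open>m * m\<close> and \<open>2000 * m\<close>. The
  constant work contributes \<open>2 * n * (59 + 2 * m * 59)\<close>.\<close>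

lemma sum_bucket_cost:
  "(\<Sum>k<2 * n. 9 + bucket_cost k) \<le> 118 * n + 236 * n * m + 4000 * m * m + 2000 * m"
proof -
  have "(\<Sum>k<2 * n. \<Sum>i<2 * m. if arc_key i = k then 2 * m * 1000 + 1000 else 0) =
      (\<Sum>i<2 * m. \<Sum>k<2 * n. if arc_key i = k then 2 * m * 1000 + 1000 else 0)"
    by (rule sum.swap)
  also have "\<dots> = 2 * m * (2 * m * 1000 + 1000)"
    using arc_key_less by simp
  finally have "(\<Sum>k<2 * n. \<Sum>i<2 * m. if arc_key i = k then 2 * m * 1000 + 1000 else 0) =
      2 * m * (2 * m * 1000 + 1000)" .
  moreover have "(\<Sum>k<2 * n. 9 + bucket_cost k) = 2 * n * (59 + 2 * m * 59) +
     (\<Sum>k<2 * n. \<Sum>i<2 * m. if arc_key i = k then 2 * m * 1000 + 1000 else 0)"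
    unfolding bucket_cost_def scan_cost_def by (simp add: sum.distrib algebra_simps)
  ultimately show ?thesis by (simp add: algebra_simps)
qed

lemma compute_chains:
  assumes "env s" "table {} (s ''len'') (s ''pred'')"
  shows "wpt W compute_chains (\<lambda>t s'. t \<le> 118 * n + 236 * n * m + 4000 * m * m + 2000 * m + 13 \<and>
    env s' \<and> table {..<2 * m} (s' ''len'') (s' ''pred'')) s"
proof -
  have "bucket_inv 0 (s(''k'' := (s ''k'')(0 := 0)))"
    using assms unfolding bucket_inv_def by (simp add: scanned_simps)
  then have "wpt W (While (below_double ''k'' ''n'') process_bucket)
      (\<lambda>t s'. t \<le> (\<Sum>k<2 * n. 9 + bucket_cost k) + 9 \<and> bucket_inv (2 * n) s')
      (s(''k'' := (s ''k'')(0 := 0)))"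
    by (rule wpt_While_below_double[where I = bucket_inv and B = bucket_cost])
      (use process_bucket word env_sizes in \<open>auto simp: bucket_inv_def\<close>)
  then have "wpt W (While (below_double ''k'' ''n'') process_bucket)
      (\<lambda>t s'. t + 3 \<le> 118 * n + 236 * n * m + 4000 * m * m + 2000 * m + 13 \<and>
        env s' \<and> table {..<2 * m} (s' ''len'') (s' ''pred''))
      (s(''k'' := (s ''k'')(0 := 0)))"
    by (rule wpt_mono) (use sum_bucket_cost in \<open>auto simp: bucket_inv_def scanned_simps\<close>)
  then show ?thesis
    unfolding compute_chains_def using word
    by (simp add: wpt_Seq wpt_Assign)
qed

section \<open>Extraction of a longest chain\<close>

lemma complete_table_le:
  assumes "table {..<2 * m} L R" shows "L p \<le> 2 * n"
  using assms arc_key_less[of p] table_bound[OF assms, of p] unfolding table_def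
  by (cases "p < 2 * m") auto

lemma find_best:
  assumes env: "env s" and L: "s ''len'' = L" and R: "s ''pred'' = R" and tab: "table {..<2 * m} L R"
  shows "wpt W find_best (\<lambda>t s'. t \<le> 2 * m * 100 + 100 \<and> env s' \<and> s' ''len'' = L \<and> s' ''pred'' = R \<and>
    s' ''best'' 0 \<le> 2 * m \<and> (\<forall>p<2 * m. L p \<le> L (s' ''best'' 0))) s"
proof -
  define I where "I j s' \<longleftrightarrow> env s' \<and> s' ''len'' = L \<and> s' ''pred'' = R \<and> s' ''p'' 0 = j \<and>
    s' ''best'' 0 \<le> 2 * m \<and> (\<forall>p<j. L p \<le> L (s' ''best'' 0))" for j s'
  have init: "I 0 (s(''best'' := (s ''best'')(0 := 0), ''p'' := (s ''p'')(0 := 0)))"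
    using env L R unfolding I_def by simp
  have loop: "wpt W (While (below_double ''p'' ''m'')
       (Seq (Cond (Less (Cell ''len'' (var ''best'')) (Cell ''len'' (var ''p'')))
              (set_var ''best'' (var ''p'')) Skip)
            (incr ''p'')))
      (\<lambda>t s'. t \<le> (\<Sum>k<2 * m. 9 + 50) + 9 \<and> I (2 * m) s')
      (s(''best'' := (s ''best'')(0 := 0), ''p'' := (s ''p'')(0 := 0)))"
  proof -
    have body: "wpt W (Seq (Cond (Less (Cell ''len'' (var ''best'')) (Cell ''len'' (var ''p'')))
              (set_var ''best'' (var ''p'')) Skip)
            (incr ''p'')) (\<lambda>t s'. t \<le> 50 \<and> I (Suc j) s') s'"
      if "j < 2 * m" "I j s'" for j s'
      using that complete_table_le[OF tab, of j] complete_table_le[OF tab, of "s' ''best'' 0"] word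
      by (fastforce simp: wpt_simps I_def less_Suc_eq)
    show ?thesis
      by (rule wpt_While_below_double[where I = I and B = "\<lambda>_. 50", OF init _ _ body])
        (use word env_sizes in \<open>auto simp: I_def\<close>)
  qed
  then have "wpt W (While (below_double ''p'' ''m'')
       (Seq (Cond (Less (Cell ''len'' (var ''best'')) (Cell ''len'' (var ''p'')))
              (set_var ''best'' (var ''p'')) Skip)
            (incr ''p'')))
      (\<lambda>t s'. t + 6 \<le> 2 * m * 100 + 100 \<and> env s' \<and> s' ''len'' = L \<and> s' ''pred'' = R \<and>
         s' ''best'' 0 \<le> 2 * m \<and> (\<forall>p<2 * m. L p \<le> L (s' ''best'' 0)))
      (s(''best'' := (s ''best'')(0 := 0), ''p'' := (s ''p'')(0 := 0)))"
    by (rule wpt_mono) (auto simp: I_def)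
  then show ?thesis
    unfolding find_best_def using word by (simp add: wpt_Seq wpt_Assign)
qed

text \<open>Each step along \<open>R\<close> lowers \<open>L\<close> by exactly 1. Indices outside
  the table have \<open>L\<close> equal to 0, so a positive length keeps the trace among the
  arcs.\<close>

lemma trace_back:
  assumes tab: "table {..<2 * m} L R" and "i < L b"
  shows "(R ^^ i) b < 2 * m \<and> L ((R ^^ i) b) + i = L b \<and>
    (Suc i < L b \<longrightarrow> arc_prec ((R ^^ Suc i) b) ((R ^^ i) b))"
  using assms(2)
proof (induction i)
  case 0
  have "b < 2 * m"
  proof (rule ccontr)
    assume "\<not> b < 2 * m"
    then have "L b = 0" using tab unfolding table_def by simp
    with 0 show False by simp
  qed
  then have "good L R b" using tab unfolding table_def by simp
  then show ?case using \<open>b < 2 * m\<close> unfolding good_def by auto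
next
  case (Suc i)
  define p where "p = (R ^^ i) b"
  have p: "p < 2 * m" "L p + i = L b" using Suc unfolding p_def by auto
  then have "good L R p" using tab unfolding table_def by simp
  \<comment> \<open>Since \<open>Suc i < L b\<close>, the length at \<open>p\<close> exceeds 1, so
    \<open>R p\<close> is a genuine predecessor.\<close>
  then have R: "R p < 2 * m" "L (R p) + Suc i = L b" using p Suc.prems unfolding good_def by auto
  then have "good L R (R p)" using tab unfolding table_def by simp
  then show ?case using R unfolding good_def by (auto simp flip: p_def)
qed

lemma output_chain:
  assumes env: "env s" and L: "s ''len'' = L" and R: "s ''pred'' = R" and tab: "table {..<2 * m} L R"
    and b: "s ''best'' 0 = b" "b \<le> 2 * m"
  shows "wpt W output_chain (\<lambda>t s'. t \<le> 2 * n * 100 + 100 \<and> s' ''out_size'' 0 = L b \<and>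
    (\<forall>i<L b. (s' ''out_fst'' i, s' ''out_snd'' i) = arcs ! ((R ^^ i) b))) s"
proof -
  define I where "I j s' \<longleftrightarrow> env s' \<and> s' ''len'' = L \<and> s' ''pred'' = R \<and> s' ''p'' 0 = (R ^^ j) b \<and>
    s' ''out_size'' 0 = j \<and> s' ''total'' 0 = L b \<and>
    (\<forall>i<j. (s' ''out_fst'' i, s' ''out_snd'' i) = arcs ! ((R ^^ i) b))" for j s'
  let ?test = "Less (var ''out_size'') (var ''total'')"
  let ?body = "Seq (Assign ''out_fst'' (var ''out_size'') (Cell ''center'' (var ''p'')))
       (Seq (Assign ''out_snd'' (var ''out_size'') (Cell ''leaf'' (var ''p'')))
       (Seq (set_var ''p'' (Cell ''pred'' (var ''p'')))
            (incr ''out_size'')))"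
  let ?s = "s(''p'' := (s ''p'')(0 := b), ''out_size'' := (s ''out_size'')(0 := 0),
    ''total'' := (s ''total'')(0 := L b))"
  have Lb: "L b \<le> 2 * n" using complete_table_le[OF tab] .
  have init: "I 0 ?s" using env L R unfolding I_def by simp
  have body: "wpt W ?body (\<lambda>t s'. t \<le> 50 \<and> I (Suc j) s') s'" if j: "j < L b" and I: "I j s'" for j s'
  proof -
    let ?p = "(R ^^ j) b"
    have p: "?p < 2 * m" using trace_back[OF tab j] by simp
    have s': "env s'" "s' ''len'' = L" "s' ''pred'' = R" "s' ''p'' 0 = ?p" "s' ''out_size'' 0 = j"
      "s' ''total'' 0 = L b" "\<forall>i<j. (s' ''out_fst'' i, s' ''out_snd'' i) = arcs ! ((R ^^ i) b)"
      using I unfolding I_def by blast+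
    have cells: "s' ''center'' ?p = fst (arcs ! ?p)" "s' ''leaf'' ?p = snd (arcs ! ?p)"
      using s'(1) p unfolding env_def by auto
    \<comment> \<open>The last round also reads a predecessor, at an arc of length 1 where it
      carries no meaning. It is never followed but has to fit into a word.\<close>
    have "R ?p \<le> 2 * m" using tab unfolding table_def by simp
    then show ?thesis
      using s' cells p arcs_less[OF p] Lb j word
      by (auto simp: wpt_simps I_def less_Suc_eq)
  qed
  have "wpt W (While ?test ?body)
      (\<lambda>t s'. t \<le> L b * (test_cost ?test + 1 + 50) + test_cost ?test + 1 \<and> I (L b) s') ?s"
  proof (rule wpt_While_bounded[OF init _ body])
    fix j s' assume "j \<le> L b" "I j s'"
    then have "s' ''out_size'' 0 = j" "s' ''total'' 0 = L b" unfolding I_def by auto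
    then show "test_fits W s' ?test \<and> (holds s' ?test \<longleftrightarrow> j < L b)"
      using \<open>j \<le> L b\<close> Lb word by simp
  qed
  then have "wpt W (While ?test ?body)
      (\<lambda>t s'. t + 12 \<le> 2 * n * 100 + 100 \<and> s' ''out_size'' 0 = L b \<and>
        (\<forall>i<L b. (s' ''out_fst'' i, s' ''out_snd'' i) = arcs ! ((R ^^ i) b))) ?s"
    by (rule wpt_mono) (use Lb in \<open>auto simp: I_def\<close>)
  then show ?thesis
    unfolding output_chain_def using L b Lb word by (simp add: wpt_Seq wpt_Assign)
qed

lemma output_correct:
  assumes tab: "table {..<2 * m} L R" and b: "\<And>p. p < 2 * m \<Longrightarrow> L p \<le> L b"
    and size: "s ''out_size'' 0 = L b"
    and out: "\<And>i. i < L b \<Longrightarrow> (s ''out_fst'' i, s ''out_snd'' i) = arcs ! ((R ^^ i) b)"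
  shows "\<exists>D. edge_list D (output_edges s) \<and> edge_open_packing E D \<and>
    card D = edge_open_packing_number E"
proof -
  define ps where "ps = output_edges s"
  define D where "D = edge_of ` set ps"
  have len: "length ps = L b" unfolding ps_def output_edges_def size by simp
  have nth: "ps ! i = arcs ! ((R ^^ i) b)" if "i < L b" for i
    using that out unfolding ps_def output_edges_def size by simp
  have edge: "edge_of p \<in> E" if p: "p \<in> set ps" for p
  proof -
    obtain i where "i < L b" "p = ps ! i" using p len by (metis in_set_conv_nth)
    then have "p \<in> set arcs" using trace_back[OF tab, of i b] nth length_arcs by simp
    then show ?thesis using set_arcs by simp
  qed
  have transp: "transp (\<lambda>p q. prec q p)"
    using transp_prec unfolding transp_def by blast
  \<comment> \<open>By transitivity only consecutive arcs need to be compared, and these are related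
    by \<open>trace_back\<close>.\<close>
  have "sorted_wrt (\<lambda>p q. prec q p) ps"
    unfolding sorted_wrt_iff_nth_Suc_transp[OF transp]
    using trace_back[OF tab] nth len unfolding arc_prec_def by simp
  note chain = packing_of_chain[OF this edge]
  then have D: "edge_open_packing E D" "card D = L b" unfolding D_def len by auto
  define index where "index p = (SOME i. i < 2 * m \<and> arcs ! i = p)" for p
  have index: "index p < 2 * m \<and> arcs ! index p = p" if "edge_of p \<in> E" for p
  proof -
    have "p \<in> set arcs" using that set_arcs by simp
    then have "\<exists>i. i < 2 * m \<and> arcs ! i = p" using length_arcs by (metis in_set_conv_nth)
    then show ?thesis unfolding index_def by (rule someI_ex)
  qed
  have good: "good L R (index p)" if "edge_of p \<in> E" for p
    using tab index[OF that] unfolding table_def by simp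
  \<comment> \<open>The potential is the table read at the position of an arc; \<open>good\<close>
    makes it strictly increasing and the choice of \<open>b\<close> bounds it.\<close>
  have "card D' \<le> L b" if "edge_open_packing E D'" for D'
  proof (rule card_packing_le[OF that, where h = "\<lambda>p. L (index p)"])
    fix p q assume "edge_of p \<in> E" "edge_of q \<in> E" "prec p q"
    then show "L (index p) < L (index q)"
      using index[of p] index[of q] good[of q] unfolding good_def arc_prec_def by fastforce
  next
    fix p assume "edge_of p \<in> E"
    then show "1 \<le> L (index p) \<and> L (index p) \<le> L b"
      using b index[of p] good[of p] unfolding good_def by auto
  qed
  then have "edge_open_packing_number E = card D"
    using D by (intro edge_open_packing_number_eq) auto
  moreover have "(\<lambda>(u, v). {u, v}) ` set ps = D"
    unfolding D_def by (simp add: case_prod_beta)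
  then have "edge_list D ps"
    unfolding edge_list_def using D(2) len by simp
  ultimately show ?thesis using D(1) unfolding ps_def by auto
qed

end


section \<open>Positions and arcs of the input\<close>

definition pos :: "'a list \<Rightarrow> 'a \<Rightarrow> nat" where
  "pos xs = inv_into {..<length xs} ((!) xs)"

lemma pos_nth: "distinct xs \<Longrightarrow> i < length xs \<Longrightarrow> pos xs (xs ! i) = i"
  unfolding pos_def by (intro inv_into_f_f) (auto intro: inj_on_nth)

lemma pos_less: "distinct xs \<Longrightarrow> v \<in> set xs \<Longrightarrow> pos xs v < length xs \<and> xs ! pos xs v = v"
  by (metis in_set_conv_nth pos_nth)

text \<open>Sortedness gives one direction; antisymmetry excludes that both \<open>(u, v)\<close>
  and \<open>(v, u)\<close> lie in \<open>r\<close>, which gives the other.\<close>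

lemma order_list_pos:
  assumes "order_list V r xs" "linear_order_on V r" "u \<in> V" "v \<in> V" "u \<noteq> v"
  shows "(u, v) \<in> r \<longleftrightarrow> pos xs u < pos xs v" "pos xs u \<noteq> pos xs v"
proof -
  have xs: "distinct xs" "set xs = V" "sorted_wrt (\<lambda>u v. (u, v) \<in> r) xs"
    using assms(1) unfolding order_list_def by auto
  have u: "pos xs u < length xs" "xs ! pos xs u = u" and v: "pos xs v < length xs" "xs ! pos xs v = v"
    using pos_less[OF xs(1)] assms(3,4) xs(2) by auto
  show neq: "pos xs u \<noteq> pos xs v" using u v assms(5) by metis
  have less: "(xs ! i, xs ! j) \<in> r" if "i < j" "j < length xs" for i j
    using sorted_wrt_nth_less[OF xs(3) that] .
  have "antisym r"
    using assms(2) unfolding linear_order_on_def partial_order_on_def by blast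
  then have "\<not> ((u, v) \<in> r \<and> (v, u) \<in> r)" using assms(5) by (auto dest: antisymD)
  moreover have "pos xs u < pos xs v \<Longrightarrow> (u, v) \<in> r" "pos xs v < pos xs u \<Longrightarrow> (v, u) \<in> r"
    using less[of "pos xs u" "pos xs v"] less[of "pos xs v" "pos xs u"] u v by auto
  ultimately show "(u, v) \<in> r \<longleftrightarrow> pos xs u < pos xs v" using neq by (meson linorder_neqE_nat)
qed

section \<open>Correctness of the preprocessing\<close>

lemma compute_positions:
  assumes xs: "distinct xs" "set xs = {..<n}" and ys: "distinct ys" "set ys = {..<n}"
    and s: "s ''n'' 0 = n" "s ''order1'' = array xs" "s ''order2'' = array ys" and W: "n + 1 \<le> W"
  shows "wpt W compute_positions (\<lambda>t s'. t \<le> 100 * n + 100 \<and>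
    (\<forall>v<n. s' ''pos1'' v = pos xs v \<and> s' ''pos2'' v = pos ys v) \<and>
    (\<forall>x. x \<notin> {''i'', ''pos1'', ''pos2''} \<longrightarrow> s' x = s x)) s"
proof -
  have len: "length xs = n" "length ys = n"
    using distinct_card[OF xs(1)] distinct_card[OF ys(1)] xs(2) ys(2) by auto
  define I where "I k s' \<longleftrightarrow> s' ''i'' 0 = k \<and>
    (\<forall>j<k. s' ''pos1'' (xs ! j) = j \<and> s' ''pos2'' (ys ! j) = j) \<and>
    (\<forall>x. x \<notin> {''i'', ''pos1'', ''pos2''} \<longrightarrow> s' x = s x)" for k and s' :: mem
  let ?test = "Less (var ''i'') (var ''n'')"
  let ?body = "Seq (Assign ''pos1'' (Cell ''order1'' (var ''i'')) (var ''i''))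
     (Seq (Assign ''pos2'' (Cell ''order2'' (var ''i'')) (var ''i''))
          (incr ''i''))"
  let ?s = "s(''i'' := (s ''i'')(0 := 0))"
  have init: "I 0 ?s" unfolding I_def by simp
  have body: "wpt W ?body (\<lambda>t s'. t \<le> 50 \<and> I (Suc k) s') s'" if k: "k < n" and I: "I k s'" for k s'
  proof -
    have s': "s' ''i'' 0 = k" "\<forall>j<k. s' ''pos1'' (xs ! j) = j \<and> s' ''pos2'' (ys ! j) = j"
      "\<And>x. x \<notin> {''i'', ''pos1'', ''pos2''} \<Longrightarrow> s' x = s x"
      using I unfolding I_def by blast+
    have ord: "s' ''order1'' k = xs ! k" "s' ''order2'' k = ys ! k" "xs ! k < n" "ys ! k < n"
      using s'(3) s k len xs(2) ys(2) nth_mem[of k xs] nth_mem[of k ys] by (auto simp: array_def)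
    \<comment> \<open>Distinctness ensures that round \<open>k\<close> does not overwrite a position
      stored earlier.\<close>
    have neq: "xs ! j \<noteq> xs ! k" "ys ! j \<noteq> ys ! k" if "j < k" for j
      using that k len xs(1) ys(1) by (auto simp: nth_eq_iff_index_eq)
    show ?thesis
      using s' ord neq k W by (auto simp: wpt_simps I_def less_Suc_eq)
  qed
  have "wpt W (While ?test ?body) (\<lambda>t s'. t \<le> n * (test_cost ?test + 1 + 50) + test_cost ?test + 1 \<and> I n s') ?s"
  proof (rule wpt_While_bounded[OF init _ body])
    fix k s' assume "k \<le> n" "I k s'"
    then have "s' ''i'' 0 = k" "s' ''n'' 0 = n" using s unfolding I_def by auto
    then show "test_fits W s' ?test \<and> (holds s' ?test \<longleftrightarrow> k < n)"
      using \<open>k \<le> n\<close> W by simp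
  qed
  then have "wpt W (While ?test ?body) (\<lambda>t s'. t + 3 \<le> 100 * n + 100 \<and>
    (\<forall>v<n. s' ''pos1'' v = pos xs v \<and> s' ''pos2'' v = pos ys v) \<and>
    (\<forall>x. x \<notin> {''i'', ''pos1'', ''pos2''} \<longrightarrow> s' x = s x)) ?s"
  proof (rule wpt_mono)
    fix t s' assume a: "t \<le> n * (test_cost ?test + 1 + 50) + test_cost ?test + 1 \<and> I n s'"
    have "s' ''pos1'' v = pos xs v \<and> s' ''pos2'' v = pos ys v" if "v < n" for v
    proof -
      have "v \<in> set xs" "v \<in> set ys" using that xs(2) ys(2) by auto
      then have "pos xs v < n" "xs ! pos xs v = v" "pos ys v < n" "ys ! pos ys v = v"
        using pos_less[OF xs(1)] pos_less[OF ys(1)] len by auto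
      then show ?thesis using a unfolding I_def by metis
    qed
    then show "t + 3 \<le> 100 * n + 100 \<and>
      (\<forall>v<n. s' ''pos1'' v = pos xs v \<and> s' ''pos2'' v = pos ys v) \<and>
      (\<forall>x. x \<notin> {''i'', ''pos1'', ''pos2''} \<longrightarrow> s' x = s x)"
      using a unfolding I_def by auto
  qed
  then show ?thesis
    unfolding compute_positions_def using W by (simp add: wpt_Seq wpt_Assign)
qed

lemma compute_arcs:
  assumes m: "length es = m" and es: "\<And>u v. (u, v) \<in> set es \<Longrightarrow> u < n \<and> v < n"
    and s: "s ''m'' 0 = m" "s ''edge_fst'' = array (map fst es)" "s ''edge_snd'' = array (map snd es)"
    and W: "n + 2 * m + 1 \<le> W"
  shows "wpt W compute_arcs (\<lambda>t s'. t \<le> 100 * m + 100 \<and>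
    (\<forall>p<2 * m. s' ''center'' p = fst ((es @ map prod.swap es) ! p) \<and>
       s' ''leaf'' p = snd ((es @ map prod.swap es) ! p)) \<and>
    (\<forall>x. x \<notin> {''i'', ''center'', ''leaf''} \<longrightarrow> s' x = s x)) s"
proof -
  define I where "I k s' \<longleftrightarrow> s' ''i'' 0 = k \<and>
    (\<forall>j<k. s' ''center'' j = fst (es ! j) \<and> s' ''leaf'' j = snd (es ! j) \<and>
       s' ''center'' (m + j) = snd (es ! j) \<and> s' ''leaf'' (m + j) = fst (es ! j)) \<and>
    (\<forall>x. x \<notin> {''i'', ''center'', ''leaf''} \<longrightarrow> s' x = s x)" for k and s' :: mem
  let ?test = "Less (var ''i'') (var ''m'')"
  let ?body = "Seq (Assign ''center'' (var ''i'') (Cell ''edge_fst'' (var ''i'')))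
     (Seq (Assign ''leaf'' (var ''i'') (Cell ''edge_snd'' (var ''i'')))
     (Seq (Assign ''center'' (Add (var ''m'') (var ''i'')) (Cell ''edge_snd'' (var ''i'')))
     (Seq (Assign ''leaf'' (Add (var ''m'') (var ''i'')) (Cell ''edge_fst'' (var ''i'')))
          (incr ''i''))))"
  let ?s = "s(''i'' := (s ''i'')(0 := 0))"
  have init: "I 0 ?s" unfolding I_def by simp
  have body: "wpt W ?body (\<lambda>t s'. t \<le> 50 \<and> I (Suc k) s') s'" if k: "k < m" and I: "I k s'" for k s'
  proof -
    have s': "s' ''i'' 0 = k"
      "\<forall>j<k. s' ''center'' j = fst (es ! j) \<and> s' ''leaf'' j = snd (es ! j) \<and>
         s' ''center'' (m + j) = snd (es ! j) \<and> s' ''leaf'' (m + j) = fst (es ! j)"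
      "\<And>x. x \<notin> {''i'', ''center'', ''leaf''} \<Longrightarrow> s' x = s x"
      using I unfolding I_def by blast+
    have "(fst (es ! k), snd (es ! k)) \<in> set es" using k m by simp
    then have "fst (es ! k) < n" "snd (es ! k) < n" using es by blast+
    moreover have "s' ''edge_fst'' k = fst (es ! k)" "s' ''edge_snd'' k = snd (es ! k)" "s' ''m'' 0 = m"
      using s'(3) s k m by (simp_all add: array_def)
    ultimately have ends: "s' ''edge_fst'' k = fst (es ! k)" "s' ''edge_snd'' k = snd (es ! k)"
      "s' ''m'' 0 = m" "fst (es ! k) < n" "snd (es ! k) < n" by auto
    show ?thesis
      unfolding wpt_simps using s' ends k W by (simp add: I_def All_less_Suc)
  qed
  have "wpt W (While ?test ?body) (\<lambda>t s'. t \<le> m * (test_cost ?test + 1 + 50) + test_cost ?test + 1 \<and> I m s') ?s"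
  proof (rule wpt_While_bounded[OF init _ body])
    fix k s' assume "k \<le> m" "I k s'"
    then have "s' ''i'' 0 = k" "s' ''m'' 0 = m" using s unfolding I_def by auto
    then show "test_fits W s' ?test \<and> (holds s' ?test \<longleftrightarrow> k < m)"
      using \<open>k \<le> m\<close> W by simp
  qed
  then have "wpt W (While ?test ?body) (\<lambda>t s'. t + 3 \<le> 100 * m + 100 \<and>
    (\<forall>p<2 * m. s' ''center'' p = fst ((es @ map prod.swap es) ! p) \<and>
       s' ''leaf'' p = snd ((es @ map prod.swap es) ! p)) \<and>
    (\<forall>x. x \<notin> {''i'', ''center'', ''leaf''} \<longrightarrow> s' x = s x)) ?s"
  proof (rule wpt_mono)
    fix t s' assume a: "t \<le> m * (test_cost ?test + 1 + 50) + test_cost ?test + 1 \<and> I m s'"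
    have "s' ''center'' p = fst ((es @ map prod.swap es) ! p) \<and>
       s' ''leaf'' p = snd ((es @ map prod.swap es) ! p)" if "p < 2 * m" for p
    proof (cases "p < m")
      case True
      then show ?thesis using a m unfolding I_def by (simp add: nth_append)
    next
      case False
      define j where "j = p - m"
      have "p = m + j" "j < m" using False that unfolding j_def by auto
      then show ?thesis using a m unfolding I_def by (simp add: nth_append)
    qed
    then show "t + 3 \<le> 100 * m + 100 \<and>
      (\<forall>p<2 * m. s' ''center'' p = fst ((es @ map prod.swap es) ! p) \<and>
         s' ''leaf'' p = snd ((es @ map prod.swap es) ! p)) \<and>
      (\<forall>x. x \<notin> {''i'', ''center'', ''leaf''} \<longrightarrow> s' x = s x)"
      using a unfolding I_def by auto
  qed
  then show ?thesis
    unfolding compute_arcs_def using W by (simp add: wpt_Seq wpt_Assign)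
qed

lemma arc_program_input:
  assumes graph: "simple_graph {..<n} E" and rep: "permutation_representation {..<n} E r1 r2"
    and es: "edge_list E es" and xs: "order_list {..<n} r1 xs" and ys: "order_list {..<n} r2 ys"
    and W: "4 * n + 4 * length es + 4 \<le> W"
  shows "arc_program E (pos xs) (pos ys) n (length es) W (es @ map prod.swap es)"
proof
  have edge: "e \<subseteq> {..<n} \<and> card e = 2" if "e \<in> E" for e
    using graph that unfolding simple_graph_def by blast
  have E: "E = (\<lambda>(u, v). {u, v}) ` set es" using es unfolding edge_list_def by simp
  show "finite E" unfolding E by simp
  show "card e = 2" if "e \<in> E" for e using edge that by blast
  have dist: "distinct xs" "set xs = {..<n}" "distinct ys" "set ys = {..<n}"
    using xs ys unfolding order_list_def by auto
  have lin: "linear_order_on {..<n} r1" "linear_order_on {..<n} r2"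
    using rep unfolding permutation_representation_def by auto
  show "{u, v} \<in> E \<longleftrightarrow> \<not> (pos xs u < pos xs v \<and> pos ys u < pos ys v) \<and>
      \<not> (pos xs v < pos xs u \<and> pos ys v < pos ys u)"
    if "u \<in> \<Union>E" "v \<in> \<Union>E" "u \<noteq> v" for u v
  proof -
    have uv: "u \<in> {..<n}" "v \<in> {..<n}" using that edge by blast+
    have "{u, v} \<in> E \<longleftrightarrow> (u, v) \<in> r1 \<and> (v, u) \<in> r2 \<or> (v, u) \<in> r1 \<and> (u, v) \<in> r2"
      using rep uv that(3) unfolding permutation_representation_def by blast
    \<comment> \<open>Positions of distinct vertices differ in both orders, so occurring in opposite
      orders is the negation of agreeing.\<close>
    then show ?thesis
      using order_list_pos[OF xs lin(1) uv that(3)] order_list_pos[OF ys lin(2) uv that(3)]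
        order_list_pos[OF xs lin(1) uv(2,1)] order_list_pos[OF ys lin(2) uv(2,1)] that(3)
      by (metis linorder_neqE_nat order_less_asym)
  qed
  show "length (es @ map prod.swap es) = 2 * length es" by simp
  show arcs: "set (es @ map prod.swap es) = {p. edge_of p \<in> E}"
    unfolding E by (auto simp: doubleton_eq_iff image_iff split: prod.splits) force+
  show "fst ((es @ map prod.swap es) ! p) < n \<and> snd ((es @ map prod.swap es) ! p) < n"
    if "p < 2 * length es" for p
  proof -
    have "(es @ map prod.swap es) ! p \<in> {p. edge_of p \<in> E}"
      unfolding arcs[symmetric] using that by (intro nth_mem) simp
    then show ?thesis using edge by fastforce
  qed
  show "pos xs v < n \<and> pos ys v < n" if "v < n" for v
  proof -
    have "length xs = n" "length ys = n"
      using distinct_card[OF dist(1)] distinct_card[OF dist(3)] dist(2,4) by auto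
    then show ?thesis using pos_less[OF dist(1)] pos_less[OF dist(3)] that dist(2,4) by auto
  qed
  show "4 * n + 4 * length es + 4 \<le> W" by (rule W)
qed

section \<open>Composition of the phases\<close>

lemma wpt_SeqI:
  "wpt W c1 P s \<Longrightarrow> (\<And>t s'. P t s' \<Longrightarrow> wpt W c2 (\<lambda>t2. Q (t + t2)) s') \<Longrightarrow> wpt W (Seq c1 c2) Q s"
  unfolding wpt_Seq by (rule wpt_mono)

lemma packing_program:
  assumes graph: "simple_graph {..<n} E" and rep: "permutation_representation {..<n} E r1 r2"
    and es: "edge_list E es" and xs: "order_list {..<n} r1 xs" and ys: "order_list {..<n} r2 ys"
    and W: "4 * n + 4 * length es + 4 \<le> W" and m: "m = length es"
  shows "wpt W packing_program (\<lambda>t s'.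
      t \<le> 500 * n + 236 * n * m + 4000 * m * m + 2500 * m + 500 \<and>
      (\<exists>D. edge_list D (output_edges s') \<and> edge_open_packing E D \<and>
         card D = edge_open_packing_number E)) (input_mem n es xs ys)"
proof -
  interpret arc_program E "pos xs" "pos ys" n m W "es @ map prod.swap es"
    unfolding m by (rule arc_program_input[OF graph rep es xs ys W])
  let ?s = "input_mem n es xs ys"
  have input: "?s ''n'' 0 = n" "?s ''m'' 0 = m" "?s ''edge_fst'' = array (map fst es)"
    "?s ''edge_snd'' = array (map snd es)" "?s ''order1'' = array xs" "?s ''order2'' = array ys"
    "?s ''len'' = (\<lambda>_. 0)" "?s ''pred'' = (\<lambda>_. 0)"
    unfolding input_mem_def array_def m by (auto simp: fun_eq_iff)
  have ends: "u < n \<and> v < n" if "(u, v) \<in> set es" for u v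
  proof -
    have "{u, v} \<in> E" using es that unfolding edge_list_def by force
    then show ?thesis using graph unfolding simple_graph_def by blast
  qed
  have dist: "distinct xs" "set xs = {..<n}" "distinct ys" "set ys = {..<n}"
    using xs ys unfolding order_list_def by auto
  show ?thesis
    unfolding packing_program_def
  proof (rule wpt_SeqI)
    show "wpt W compute_positions (\<lambda>t s'. t \<le> 100 * n + 100 \<and>
      (\<forall>v<n. s' ''pos1'' v = pos xs v \<and> s' ''pos2'' v = pos ys v) \<and>
      (\<forall>x. x \<notin> {''i'', ''pos1'', ''pos2''} \<longrightarrow> s' x = ?s x)) ?s"
      by (rule compute_positions[OF dist]) (use input word in auto)
  next
    fix t1 s1 assume 1: "t1 \<le> 100 * n + 100 \<and>
      (\<forall>v<n. s1 ''pos1'' v = pos xs v \<and> s1 ''pos2'' v = pos ys v) \<and>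
      (\<forall>x. x \<notin> {''i'', ''pos1'', ''pos2''} \<longrightarrow> s1 x = ?s x)"
    let ?post = "\<lambda>t s'. t \<le> 500 * n + 236 * n * m + 4000 * m * m + 2500 * m + 500 \<and>
      (\<exists>D. edge_list D (output_edges s') \<and> edge_open_packing E D \<and>
         card D = edge_open_packing_number E)"
    show "wpt W (Seq compute_arcs (Seq compute_chains (Seq find_best output_chain)))
      (\<lambda>t. ?post (t1 + t)) s1"
    proof (rule wpt_SeqI)
      show "wpt W compute_arcs (\<lambda>t s'. t \<le> 100 * m + 100 \<and>
        (\<forall>p<2 * m. s' ''center'' p = fst ((es @ map prod.swap es) ! p) \<and>
           s' ''leaf'' p = snd ((es @ map prod.swap es) ! p)) \<and>
        (\<forall>x. x \<notin> {''i'', ''center'', ''leaf''} \<longrightarrow> s' x = s1 x)) s1"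
        by (rule compute_arcs[OF m[symmetric] ends]) (use 1 input word in auto)
    next
      fix t2 s2 assume 2: "t2 \<le> 100 * m + 100 \<and>
        (\<forall>p<2 * m. s2 ''center'' p = fst ((es @ map prod.swap es) ! p) \<and>
           s2 ''leaf'' p = snd ((es @ map prod.swap es) ! p)) \<and>
        (\<forall>x. x \<notin> {''i'', ''center'', ''leaf''} \<longrightarrow> s2 x = s1 x)"
      have env: "env s2" unfolding env_def using 1 2 input by auto
      have tab: "table {} (s2 ''len'') (s2 ''pred'')"
        unfolding table_def using 1 2 input by auto
      show "wpt W (Seq compute_chains (Seq find_best output_chain)) (\<lambda>t. ?post (t1 + (t2 + t))) s2"
      proof (rule wpt_SeqI[OF compute_chains[OF env tab]])
        fix t3 s3 assume 3: "t3 \<le> 118 * n + 236 * n * m + 4000 * m * m + 2000 * m + 13 \<and>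
          env s3 \<and> table {..<2 * m} (s3 ''len'') (s3 ''pred'')"
        define L R where "L = s3 ''len''" and "R = s3 ''pred''"
        have env3: "env s3" and tab3: "table {..<2 * m} L R" using 3 unfolding L_def R_def by auto
        show "wpt W (Seq find_best output_chain) (\<lambda>t. ?post (t1 + (t2 + (t3 + t)))) s3"
        proof (rule wpt_SeqI[OF find_best[OF env3 _ _ tab3]])
          show "s3 ''len'' = L" "s3 ''pred'' = R" unfolding L_def R_def by auto
        next
          fix t4 s4 assume 4: "t4 \<le> 2 * m * 100 + 100 \<and> env s4 \<and> s4 ''len'' = L \<and> s4 ''pred'' = R \<and>
            s4 ''best'' 0 \<le> 2 * m \<and> (\<forall>p<2 * m. L p \<le> L (s4 ''best'' 0))"
          define b where "b = s4 ''best'' 0"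
          have "wpt W output_chain (\<lambda>t s'. t \<le> 2 * n * 100 + 100 \<and> s' ''out_size'' 0 = L b \<and>
            (\<forall>i<L b. (s' ''out_fst'' i, s' ''out_snd'' i) = (es @ map prod.swap es) ! ((R ^^ i) b))) s4"
            by (rule output_chain[OF _ _ _ tab3]) (use 4 b_def in auto)
          then show "wpt W output_chain (\<lambda>t. ?post (t1 + (t2 + (t3 + (t4 + t))))) s4"
          proof (rule wpt_mono)
            fix t5 s5 assume 5: "t5 \<le> 2 * n * 100 + 100 \<and> s5 ''out_size'' 0 = L b \<and>
              (\<forall>i<L b. (s5 ''out_fst'' i, s5 ''out_snd'' i) = (es @ map prod.swap es) ! ((R ^^ i) b))"
            have "\<exists>D. edge_list D (output_edges s5) \<and> edge_open_packing E D \<and>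
              card D = edge_open_packing_number E"
              by (rule output_correct[OF tab3, of b]) (use 4 5 b_def in auto)
            moreover have "t1 + (t2 + (t3 + (t4 + t5))) \<le>
              500 * n + 236 * n * m + 4000 * m * m + 2500 * m + 500"
              using 1 2 3 4 5 by linarith
            ultimately show "?post (t1 + (t2 + (t3 + (t4 + t5)))) s5" by blast
          qed
        qed
      qed
    qed
  qed
qed

theorem theorem6:
  shows "\<exists>(prog :: com) (C :: nat) (d :: nat).
    \<forall>(n :: nat) (E :: nat set set) (r1 :: nat rel) (r2 :: nat rel)
      (es :: (nat \<times> nat) list) (xs :: nat list) (ys :: nat list).
      simple_graph {..<n} E \<longrightarrow>
      permutation_representation {..<n} E r1 r2 \<longrightarrow>
      edge_list E es \<longrightarrow> order_list {..<n} r1 xs \<longrightarrow> order_list {..<n} r2 ys \<longrightarrow>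
      (\<exists>t s' D.
         run ((n + card E + 2) ^ d) prog (input_mem n es xs ys) t s' \<and>
         (n > 0 \<longrightarrow> t \<le> C * (n\<^sup>2 + (card E)\<^sup>2)) \<and>
         edge_list D (output_edges s') \<and>
         edge_open_packing E D \<and>
         card D = edge_open_packing_number E)"
proof (rule exI[of _ packing_program], rule exI[of _ "10000 :: nat"], rule exI[of _ "3 :: nat"],
    intro allI impI)
  fix n :: nat and E :: "nat set set" and r1 r2 :: "nat rel"
    and es :: "(nat \<times> nat) list" and xs ys :: "nat list"
  assume graph: "simple_graph {..<n} E" and rep: "permutation_representation {..<n} E r1 r2"
    and es: "edge_list E es" and xs: "order_list {..<n} r1 xs" and ys: "order_list {..<n} r2 ys"
  define m where "m = card E"
  have m: "m = length es" using es unfolding edge_list_def m_def by simp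
  \<comment> \<open>The base is at least 2, so two of the three factors already contribute
    4.\<close>
  have "4 * (n + m + 2) \<le> (n + m + 2) * (n + m + 2) * (n + m + 2)"
    by (intro mult_le_mono1) (use mult_le_mono[of 2 "n + m + 2" 2 "n + m + 2"] in simp)
  then have W: "4 * n + 4 * length es + 4 \<le> (n + card E + 2) ^ 3"
    unfolding m[symmetric] m_def[symmetric] by (simp add: power3_eq_cube)
  obtain t s' D where run: "run ((n + card E + 2) ^ 3) packing_program (input_mem n es xs ys) t s'"
    and t: "t \<le> 500 * n + 236 * n * m + 4000 * m * m + 2500 * m + 500"
    and D: "edge_list D (output_edges s')" "edge_open_packing E D" "card D = edge_open_packing_number E"
    using packing_program[OF graph rep es xs ys W m] unfolding wpt_def by blast
  have "t \<le> 10000 * (n\<^sup>2 + m\<^sup>2)" if "n > 0"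
  proof -
    have "n * m \<le> n * n + m * m"
      by (cases "n \<le> m") (auto intro: trans_le_add1 trans_le_add2)
    moreover have "n \<le> n * n" "m \<le> m * m" by (auto intro: le_square)
    moreover have "1 \<le> n * n" using that by simp
    \<comment> \<open>With \<open>a\<close>, \<open>b\<close>, \<open>c\<close> in place of
      \<open>n * n\<close>, \<open>m * m\<close>, \<open>n * m\<close> the estimate is linear. The
      additive 500 is charged to \<open>1 \<le> a\<close>, which is where \<open>n > 0\<close>
      enters.\<close>
    moreover have "t \<le> 10000 * (a + b)"
      if "c \<le> a + b" "n \<le> a" "m \<le> b" "1 \<le> a" "t \<le> 500 * n + 236 * c + 4000 * b + 2500 * m + 500"
      for a b c :: nat
      using that by simp
    ultimately show ?thesis using t unfolding power2_eq_square mult.assoc by blast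
  qed
  with run D show "\<exists>t s' D.
      run ((n + card E + 2) ^ 3) packing_program (input_mem n es xs ys) t s' \<and>
      (n > 0 \<longrightarrow> t \<le> 10000 * (n\<^sup>2 + (card E)\<^sup>2)) \<and>
      edge_list D (output_edges s') \<and> edge_open_packing E D \<and>
      card D = edge_open_packing_number E"
    unfolding m_def by blast
qed

end
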